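(* Let $\Gamma$ be a word-hyperbolic group. Choose a finite symmetric set of generators $S$, let $\sigma$ be an associated minimal presentation of the elements of $\Gamma$, and let $\Delta_{(S,\sigma)}:\mathbb{C}\Gamma\to\mathbb{C}\Gamma\otimes\mathbb{C}\Gamma$ be the associated canonical quasiderivation. Let $\mathcal{A}\Gamma$ be an unconditional Banach algebra over $\mathbb{C}\Gamma$ with defining seminorm $\|\cdot\|$. Then there exists a constant $C_0$ (depending on all chosen data) such that $$\|\Delta_{(S,\sigma)}(\alpha\beta)\|_{uc}\;\le\;C_0\big(\|\Delta_{(S,\sigma)}(\alpha)\|_{uc}\cdot\|\beta\|+\|\alpha\|\cdot\|\Delta_{(S,\sigma)}(\beta)\|_{uc}\big)$$ for all $\alpha,\beta\in\mathbb{C}\Gamma$.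
   Context: For a set $X$, $\mathbb{C}X$ is the complex vector space with basis $(u_x)_{x\in X}$; for $a=\sum a_xu_x$ put $|a|=\sum|a_x|u_x$, and write $|a|\le|b|$ if $|a_x|\le|b_x|$ for all $x$. A seminorm on $\mathbb{C}X$ is unconditional if $|a|\le|b|$ implies $\|a\|\le\|b\|$. An unconditional Banach algebra over the group ring $\mathbb{C}\Gamma$ is a Banach algebra obtained from $\mathbb{C}\Gamma$ by completion with respect to an unconditional seminorm (its defining seminorm). Canonical quasiderivation: a minimal presentation is a map $\sigma:\Gamma\to\bigcup_nS^n$ assigning to each $g\in\Gamma$ a word of minimal length in the alphabet $S$ representing $g$. If $\sigma(g)=(s_1,\dots,s_n)$, then $$\Delta_{(S,\sigma)}(u_g)=\sum_{i=0}^nu_{s_1\cdots s_i}\otimes u_{s_{i+1}\cdots s_n},$$ extended linearly (empty products are the unit). Unconditional cross-norm: identify $\mathbb{C}\Gamma\otimes\mathbb{C}\Gamma\simeq\mathbb{C}(\Gamma\times\Gamma)$. For $\gamma$ in this space, $\|\gamma\|_{uc}=\inf\sum_{i\in I}\|\alpha_i'\|\,\|\alpha_i''\|$, the infimum over all finite families $\alpha_i',\alpha_i''\in\mathbb{C}\Gamma$ with $|\gamma|\le\sum_{i\in I}|\alpha_i'|\otimes|\alpha_i''|$. $\Gamma$ is word-hyperbolic if it is finitely generated and, for some (hence every) finite symmetric generating set, its Cayley graph is a hyperbolic geodesic metric space (each edge of a geodesic triangle is contained in the $\delta$-neighbourhood of the union of the other two, for a fixed $\delta\geq 0$). *)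

theory Defs
  imports "HOL-Analysis.Analysis" "HOL-Library.Poly_Mapping"
begin

text \<open>
  The group \<open>\<Gamma>\<close> is a type of class \<open>group_add\<close>. This class is not commutative: it is the
  library's class of arbitrary groups, in additive notation. So a product
  \<open>s\<^sub>1 \<cdots> s\<^sub>n\<close> is \<open>sum_list [s\<^sub>1, \<dots>, s\<^sub>n]\<close>, an inverse is \<open>- s\<close>, and the unit is \<open>0\<close>.
  The group ring is \<open>'g \<Rightarrow>\<^sub>0 complex\<close>, whose library multiplication is convolution, with
  basis vectors \<open>u\<^sub>x = Poly_Mapping.single x 1\<close>.
\<close>


section \<open>The vector space with a given basis, and unconditional seminorms\<close>

definition pm_scale :: "complex \<Rightarrow> ('x \<Rightarrow>\<^sub>0 complex) \<Rightarrow> ('x \<Rightarrow>\<^sub>0 complex)" where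
  "pm_scale c a = Poly_Mapping.map (\<lambda>z. c * z) a"

definition pm_abs :: "('x \<Rightarrow>\<^sub>0 complex) \<Rightarrow> ('x \<Rightarrow>\<^sub>0 complex)" where
  "pm_abs a = Poly_Mapping.map (\<lambda>z. complex_of_real (cmod z)) a"

text \<open>\<open>abs_le a b\<close> is the relation \<open>|a| \<le> |b|\<close>. The order that the library puts on
  \<open>'x \<Rightarrow>\<^sub>0 'y\<close> is lexicographic and is not used.\<close>

definition abs_le :: "('x \<Rightarrow>\<^sub>0 complex) \<Rightarrow> ('x \<Rightarrow>\<^sub>0 complex) \<Rightarrow> bool" where
  "abs_le a b \<longleftrightarrow>
    (\<forall>x. cmod (Poly_Mapping.lookup a x) \<le> cmod (Poly_Mapping.lookup b x))"

definition seminorm :: "(('x \<Rightarrow>\<^sub>0 complex) \<Rightarrow> real) \<Rightarrow> bool" where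
  "seminorm N \<longleftrightarrow>
    (\<forall>a. 0 \<le> N a) \<and>
    (\<forall>a b. N (a + b) \<le> N a + N b) \<and>
    (\<forall>c a. N (pm_scale c a) = cmod c * N a)"

definition unconditional :: "(('x \<Rightarrow>\<^sub>0 complex) \<Rightarrow> real) \<Rightarrow> bool" where
  "unconditional N \<longleftrightarrow> (\<forall>a b. abs_le a b \<longrightarrow> N a \<le> N b)"


section \<open>Unconditional Banach algebras over the group ring\<close>

text \<open>The library only has real Banach algebras; the complex structure is added through
  an explicit scalar multiplication. The norm is submultiplicative, by the class
  \<open>real_normed_algebra\<close>.\<close>

locale complex_banach_algebra = vector_space scaleC
  for scaleC :: "complex \<Rightarrow> 'b::{real_normed_algebra, banach} \<Rightarrow> 'b" +
  assumes scaleC_of_real: "scaleC (complex_of_real r) x = r *\<^sub>R x"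
    and norm_scaleC: "norm (scaleC c x) = cmod c * norm x"
    and scaleC_mult_left: "scaleC c x * y = scaleC c (x * y)"
    and scaleC_mult_right: "x * scaleC c y = scaleC c (x * y)"

text \<open>\<open>\<iota>\<close> is the canonical map of the group ring to its completion for the seminorm \<open>N\<close>.
  It is an isometry with dense image in a complete space, which determines the completion up
  to isometric isomorphism; it need not be injective, as \<open>N\<close> is only a seminorm.\<close>

locale unconditional_banach_algebra = complex_banach_algebra scaleC
  for N :: "('g::group_add \<Rightarrow>\<^sub>0 complex) \<Rightarrow> real"
    and scaleC :: "complex \<Rightarrow> 'b::{real_normed_algebra, banach} \<Rightarrow> 'b"
    and \<iota> :: "('g \<Rightarrow>\<^sub>0 complex) \<Rightarrow> 'b" +
  assumes seminorm: "seminorm N"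
    and unconditional: "unconditional N"
    and embed_linear: "Vector_Spaces.linear pm_scale scaleC \<iota>"
    and embed_mult: "\<iota> (\<alpha> * \<beta>) = \<iota> \<alpha> * \<iota> \<beta>"
    and embed_norm: "norm (\<iota> \<alpha>) = N \<alpha>"
    and embed_dense: "closure (\<iota> ` UNIV) = UNIV"


section \<open>The unconditional cross-norm\<close>

text \<open>The identification of the tensor square of the group ring with \<open>\<complex>(\<Gamma> \<times> \<Gamma>)\<close> sends
  \<open>u\<^sub>x \<otimes> u\<^sub>y\<close> to \<open>u\<^bsub>(x, y)\<^esub>\<close>.\<close>

definition pm_tensor ::
    "('x \<Rightarrow>\<^sub>0 complex) \<Rightarrow> ('y \<Rightarrow>\<^sub>0 complex) \<Rightarrow> ('x \<times> 'y \<Rightarrow>\<^sub>0 complex)" where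
  "pm_tensor a b =
    (\<Sum>x\<in>Poly_Mapping.keys a. \<Sum>y\<in>Poly_Mapping.keys b.
       Poly_Mapping.single (x, y) (Poly_Mapping.lookup a x * Poly_Mapping.lookup b y))"

definition uc_norm ::
    "(('x \<Rightarrow>\<^sub>0 complex) \<Rightarrow> real) \<Rightarrow> ('x \<times> 'x \<Rightarrow>\<^sub>0 complex) \<Rightarrow> real" where
  "uc_norm N \<gamma> =
    Inf {(\<Sum>(a, b)\<leftarrow>ps. N a * N b) | ps.
           abs_le \<gamma> (\<Sum>(a, b)\<leftarrow>ps. pm_tensor (pm_abs a) (pm_abs b))}"


section \<open>The canonical quasiderivation\<close>

definition generating :: "'g::group_add set \<Rightarrow> bool" where
  "generating S \<longleftrightarrow> (\<forall>g. \<exists>w. set w \<subseteq> S \<union> uminus ` S \<and> sum_list w = g)"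

definition finite_symmetric_generating :: "'g::group_add set \<Rightarrow> bool" where
  "finite_symmetric_generating S \<longleftrightarrow> finite S \<and> uminus ` S = S \<and> generating S"

definition minimal_presentation :: "'g::group_add set \<Rightarrow> ('g \<Rightarrow> 'g list) \<Rightarrow> bool" where
  "minimal_presentation S \<sigma> \<longleftrightarrow>
    (\<forall>g. set (\<sigma> g) \<subseteq> S \<and> sum_list (\<sigma> g) = g \<and>
         (\<forall>w. set w \<subseteq> S \<and> sum_list w = g \<longrightarrow> length (\<sigma> g) \<le> length w))"

definition quasiderivation_basis ::
    "('g::group_add \<Rightarrow> 'g list) \<Rightarrow> 'g \<Rightarrow> ('g \<times> 'g \<Rightarrow>\<^sub>0 complex)" where
  "quasiderivation_basis \<sigma> g =
    (\<Sum>i\<le>length (\<sigma> g).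
       pm_tensor (Poly_Mapping.single (sum_list (take i (\<sigma> g))) 1)
                 (Poly_Mapping.single (sum_list (drop i (\<sigma> g))) 1))"

definition quasiderivation ::
    "('g::group_add \<Rightarrow> 'g list) \<Rightarrow> ('g \<Rightarrow>\<^sub>0 complex) \<Rightarrow> ('g \<times> 'g \<Rightarrow>\<^sub>0 complex)" where
  "quasiderivation \<sigma> \<alpha> =
    (\<Sum>g\<in>Poly_Mapping.keys \<alpha>.
       pm_scale (Poly_Mapping.lookup \<alpha> g) (quasiderivation_basis \<sigma> g))"


section \<open>Hyperbolic geodesic metric spaces\<close>

definition geodesic_segment ::
    "'a set \<Rightarrow> ('a \<Rightarrow> 'a \<Rightarrow> real) \<Rightarrow> 'a \<Rightarrow> 'a \<Rightarrow> 'a set \<Rightarrow> bool" where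
  "geodesic_segment M d x y A \<longleftrightarrow>
    (\<exists>l c. 0 \<le> l \<and> c 0 = x \<and> c l = y \<and> A = c ` {0..l} \<and> A \<subseteq> M \<and>
           (\<forall>s\<in>{0..l}. \<forall>t\<in>{0..l}. d (c s) (c t) = \<bar>s - t\<bar>))"

definition geodesic_space :: "'a set \<Rightarrow> ('a \<Rightarrow> 'a \<Rightarrow> real) \<Rightarrow> bool" where
  "geodesic_space M d \<longleftrightarrow>
    Metric_space M d \<and> (\<forall>x\<in>M. \<forall>y\<in>M. \<exists>A. geodesic_segment M d x y A)"

text \<open>Neighbourhoods are closed, so that \<open>\<delta> = 0\<close> is meaningful.\<close>

definition nbhd :: "'a set \<Rightarrow> ('a \<Rightarrow> 'a \<Rightarrow> real) \<Rightarrow> real \<Rightarrow> 'a set \<Rightarrow> 'a set" where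
  "nbhd M d \<delta> A = {p \<in> M. \<exists>q\<in>A. d p q \<le> \<delta>}"

definition hyperbolic_space :: "'a set \<Rightarrow> ('a \<Rightarrow> 'a \<Rightarrow> real) \<Rightarrow> bool" where
  "hyperbolic_space M d \<longleftrightarrow>
    geodesic_space M d \<and>
    (\<exists>\<delta>\<ge>0. \<forall>x y z A B C.
       geodesic_segment M d x y A \<and> geodesic_segment M d y z B \<and> geodesic_segment M d z x C \<longrightarrow>
       A \<subseteq> nbhd M d \<delta> (B \<union> C) \<and> B \<subseteq> nbhd M d \<delta> (C \<union> A) \<and> C \<subseteq> nbhd M d \<delta> (A \<union> B))"


section \<open>Cayley graphs and word-hyperbolic groups\<close>

text \<open>The Cayley graph is the simple graph with vertex set \<open>\<Gamma>\<close> and edges \<open>{g, g s}\<close> for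
  \<open>s \<in> S\<close>. Its points are given in barycentric coordinates: a point is a function
  \<open>p :: 'g \<Rightarrow> real\<close>, the formal convex combination of the vertices \<open>x\<close> with
  weights \<open>p x\<close>, supported on a single cell (a vertex or an edge). If \<open>0 \<in> S\<close>, the
  resulting loops are discarded.\<close>

definition cayley_cells :: "'g::group_add set \<Rightarrow> 'g set set" where
  "cayley_cells S = {{g} | g. True} \<union> {{g, g + s} | g s. s \<in> S}"

definition cell_points :: "'g set \<Rightarrow> ('g \<Rightarrow> real) set" where
  "cell_points C = {p. (\<forall>x. 0 \<le> p x) \<and> (\<forall>x. x \<notin> C \<longrightarrow> p x = 0) \<and> (\<Sum>x\<in>C. p x) = 1}"

definition cayley_points :: "'g::group_add set \<Rightarrow> ('g \<Rightarrow> real) set" where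
  "cayley_points S = (\<Union>C\<in>cayley_cells S. cell_points C)"

text \<open>\<open>cayley_path S p q l\<close>: some piecewise linear path of length \<open>l\<close> joins \<open>p\<close> to \<open>q\<close>. Edges
  have length 1: the points \<open>(1 - s) g + s h\<close> and \<open>(1 - t) g + t h\<close> of an edge \<open>{g, h}\<close> are joined by
  a linear piece of length \<open>|s - t|\<close>, which is half of the \<open>\<ell>\<^sup>1\<close>-distance of their coordinates.\<close>

inductive cayley_path ::
    "'g::group_add set \<Rightarrow> ('g \<Rightarrow> real) \<Rightarrow> ('g \<Rightarrow> real) \<Rightarrow> real \<Rightarrow> bool"
  for S where
  refl: "p \<in> cayley_points S \<Longrightarrow> cayley_path S p p 0"
| step: "C \<in> cayley_cells S \<Longrightarrow> p \<in> cell_points C \<Longrightarrow> q \<in> cell_points C \<Longrightarrow>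
    cayley_path S q r l \<Longrightarrow> cayley_path S p r ((\<Sum>x\<in>C. \<bar>p x - q x\<bar>) / 2 + l)"

text \<open>The path metric. The value 0 outside the Cayley graph is needed because the library locale
  \<open>Metric_space\<close> requires nonnegativity and symmetry on the whole type.\<close>

definition cayley_dist ::
    "'g::group_add set \<Rightarrow> ('g \<Rightarrow> real) \<Rightarrow> ('g \<Rightarrow> real) \<Rightarrow> real" where
  "cayley_dist S p q =
    (if p \<in> cayley_points S \<and> q \<in> cayley_points S then Inf {l. cayley_path S p q l} else 0)"

definition word_hyperbolic :: "'g::group_add itself \<Rightarrow> bool" where
  "word_hyperbolic (TYPE('g)) \<longleftrightarrow>
    (\<exists>S::'g set. finite_symmetric_generating S \<and>
       hyperbolic_space (cayley_points S) (cayley_dist S))"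

end

theory Submission
  imports Defs "HOL-Real_Asymp.Real_Asymp"
begin

text \<open>The quasiderivation of a basis vector \<open>u\<^sub>k\<close> is the sum of \<open>u\<^sub>x \<otimes> u\<^sub>y\<close> over the splittings
  \<open>k = x + y\<close> for which \<open>x\<close> lies on the chosen geodesic from the unit to \<open>k\<close>. If \<open>k = g + h\<close>, this
  geodesic is one side of a triangle whose other sides are the geodesic of \<open>g\<close> and the translate by \<open>g\<close>
  of the geodesic of \<open>h\<close>. In a hyperbolic group the triangle is thin: each such \<open>x\<close> is \<open>q + r\<close> or
  \<open>g + q + r\<close> with \<open>q\<close> on the geodesic of \<open>g\<close> or of \<open>h\<close>, and with \<open>r\<close> in a finite set \<open>B\<close> that does
  not depend on \<open>g\<close> and \<open>h\<close>. Hence every splitting of \<open>g + h\<close> comes from a splitting of \<open>g\<close>,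
  multiplied by \<open>h\<close> on the right, or from one of \<open>h\<close>, multiplied by \<open>g\<close> on the left, by inserting \<open>r\<close>
  and \<open>- r\<close> in the middle. So finite families that majorize the quasiderivations of \<open>\<alpha>\<close> and \<open>\<beta>\<close> give
  one for \<open>\<alpha> * \<beta>\<close> (\<open>majorizes_product_majorant\<close>). The norm is submultiplicative and does not change when
  coefficients are replaced by their absolute values, so the new family costs at most the sum over
  \<open>r \<in> B\<close> of \<open>N u\<^sub>r * N u\<^bsub>- r\<^esub>\<close> times what the right-hand side of the claim asks for
  (\<open>cost_product_majorant\<close>); this sum is the constant \<open>C\<^sub>0\<close>. Taking infima gives the theorem.

  The geometric difficulty is that hyperbolicity is given for the Cayley graph of some finite
  generating set, while the words of the quasiderivation are minimal for another one. In the hyperbolic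
  Cayley graph they are only quasi-geodesics, so the thinness of their triangles
  (\<open>minimal_presentation_thin_triangles\<close>) rests on the stability of quasi-geodesics, known as the Morse
  lemma. It is proved below for discrete paths in a hyperbolic geodesic space, in the two halves
  \<open>geodesic_near_quasi_geodesic\<close> and \<open>quasi_geodesic_near_geodesic\<close>.\<close>


section \<open>Betweenness and thin triangles\<close>

text \<open>Betweenness stands in for geodesic segments throughout: in a geodesic space, \<open>x\<close> lies between
  \<open>a\<close> and \<open>b\<close> iff some geodesic from \<open>a\<close> to \<open>b\<close> passes through \<open>x\<close>. So a statement about all
  points between \<open>a\<close> and \<open>b\<close> is one about all geodesics at once, and no geodesic has to be chosen.\<close>

definition (in Metric_space) between :: "'a \<Rightarrow> 'a \<Rightarrow> 'a \<Rightarrow> bool" where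
  "between a b x \<longleftrightarrow> a \<in> M \<and> b \<in> M \<and> x \<in> M \<and> d a x + d x b = d a b"

context Metric_space
begin

lemma between_commute: "between a b x \<longleftrightarrow> between b a x"
  unfolding between_def commute[of a x] commute[of x b] commute[of a b]
  by (simp only: add.commute conj_ac)

lemma between_left: "a \<in> M \<Longrightarrow> b \<in> M \<Longrightarrow> between a b a"
  unfolding between_def by auto

lemma between_same: "between a a x \<Longrightarrow> x = a"
  unfolding between_def using nonneg[of a x] nonneg[of x a]
  by (metis add_nonneg_eq_0_iff zero)

lemma between_dist_le: "between a b x \<Longrightarrow> d a x \<le> d a b"
  unfolding between_def using nonneg[of x b] by linarith

text \<open>If \<open>x\<close> is on a geodesic from \<open>a\<close> to \<open>b\<close>, its part before \<open>x\<close> can be exchanged for any other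
  geodesic from \<open>a\<close> to \<open>x\<close>; so moving from \<open>x\<close> towards \<open>a\<close> never leaves the points between
  \<open>a\<close> and \<open>b\<close>, and \<open>x\<close> stays between the new point and \<open>b\<close>.\<close>

lemma between_trans:
  assumes "between a b x" "between a x y"
  shows "between a b y" "between y b x"
  using assms triangle[of a y b] triangle[of y x b] unfolding between_def by auto

end

text \<open>This puts a prescribed point \<open>x\<close> between \<open>a\<close> and \<open>b\<close> on a geodesic. The concatenated curve is
  1-Lipschitz, and it joins points at distance equal to its length, so it cannot lose distance
  anywhere.\<close>

lemma geodesic_segment_append:
  assumes MS: "Metric_space M d"
    and A: "geodesic_segment M d a x A" and B: "geodesic_segment M d x b B"
    and btw: "d a x + d x b = d a b"
  shows "geodesic_segment M d a b (A \<union> B)"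
proof -
  interpret Metric_space M d by (fact MS)
  obtain l f where f: "0 \<le> l" "f 0 = a" "f l = x" "A = f ` {0..l}" "A \<subseteq> M"
      "\<And>s t. s \<in> {0..l} \<Longrightarrow> t \<in> {0..l} \<Longrightarrow> d (f s) (f t) = \<bar>s - t\<bar>"
    using A unfolding geodesic_segment_def by metis
  obtain m g where g: "0 \<le> m" "g 0 = x" "g m = b" "B = g ` {0..m}" "B \<subseteq> M"
      "\<And>s t. s \<in> {0..m} \<Longrightarrow> t \<in> {0..m} \<Longrightarrow> d (g s) (g t) = \<bar>s - t\<bar>"
    using B unfolding geodesic_segment_def by metis
  have l: "d a x = l" using f(6)[of 0 l] f(1-3) by auto
  have m: "d x b = m" using g(6)[of 0 m] g(1-3) by auto
  define c where "c = (\<lambda>t. if t \<le> l then f t else g (t - l))"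
  have cf: "c t = f t" if "t \<le> l" for t using that by (simp add: c_def)
  have cg: "c t = g (t - l)" if "l \<le> t" for t
    using that f(3) g(2) by (auto simp: c_def)
  have fM: "f t \<in> M" if "t \<in> {0..l}" for t using that f(4,5) by auto
  have gM: "g t \<in> M" if "t \<in> {0..m}" for t using that g(4,5) by auto
  have aM: "a \<in> M" and xM: "x \<in> M" and bM: "b \<in> M"
    using fM[of 0] fM[of l] gM[of m] f g by auto
  have cross: "d (f s) (g t) = l - s + t" if "s \<in> {0..l}" "t \<in> {0..m}" for s t
  proof -
    have "d (f s) (g t) \<le> d (f s) x + d x (g t)"
      using triangle fM gM that xM by blast
    moreover have "d a b \<le> d a (f s) + d (f s) (g t) + d (g t) b"
      using triangle[of a "f s" b] triangle[of "f s" "g t" b] fM gM that aM bM by fastforce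
    moreover have "d (f s) x = l - s" "d a (f s) = s"
      using f(6)[of s l] f(6)[of 0 s] f(1-3) that by auto
    moreover have "d x (g t) = t" "d (g t) b = m - t"
      using g(6)[of 0 t] g(6)[of t m] g(1-3) that by auto
    ultimately show ?thesis using btw l m by linarith
  qed
  have dist: "d (c s) (c t) = \<bar>s - t\<bar>" if "s \<in> {0..l + m}" "t \<in> {0..l + m}" "s \<le> t" for s t
  proof (cases "t \<le> l")
    case True then show ?thesis using that f(6)[of s t] by (simp add: cf)
  next
    case False
    show ?thesis
    proof (cases "s \<le> l")
      case True then show ?thesis using False that cross[of s "t - l"] by (simp add: cf cg)
    next
      case F: False then show ?thesis
        using False that g(6)[of "s - l" "t - l"] by (simp add: cg)
    qed
  qed
  have dist': "\<forall>s\<in>{0..l + m}. \<forall>t\<in>{0..l + m}. d (c s) (c t) = \<bar>s - t\<bar>"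
    using dist commute by (metis abs_minus_commute linear)
  have "c ` {0..l + m} = A \<union> B"
  proof (intro equalityI subsetI)
    fix p assume "p \<in> c ` {0..l + m}"
    then obtain t where t: "t \<in> {0..l + m}" "p = c t" by auto
    show "p \<in> A \<union> B"
      using t f(4) g(4) by (cases "t \<le> l") (auto simp: cf cg)
  next
    fix p assume "p \<in> A \<union> B"
    then show "p \<in> c ` {0..l + m}"
    proof
      assume "p \<in> A"
      then obtain t where "t \<in> {0..l}" "p = f t" using f by auto
      then show ?thesis using g(1) by (intro image_eqI[of _ _ t]) (auto simp: cf)
    next
      assume "p \<in> B"
      then obtain t where "t \<in> {0..m}" "p = g t" using g by auto
      then show ?thesis using f(1) by (intro image_eqI[of _ _ "t + l"]) (auto simp: cg)
    qed
  qed
  moreover have "c 0 = a" "c (l + m) = b" using f g by (auto simp: cf cg)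
  ultimately show ?thesis
    unfolding geodesic_segment_def using f(1,5) g(1,5) dist'
    by (intro exI[of _ "l + m"] exI[of _ c]) auto
qed

lemma geodesic_segment_between:
  assumes "Metric_space M d" "geodesic_segment M d a b A" "p \<in> A"
  shows "Metric_space.between M d a b p"
proof -
  interpret Metric_space M d by (fact assms)
  obtain l f where f: "0 \<le> l" "f 0 = a" "f l = b" "A = f ` {0..l}" "A \<subseteq> M"
      "\<And>s t. s \<in> {0..l} \<Longrightarrow> t \<in> {0..l} \<Longrightarrow> d (f s) (f t) = \<bar>s - t\<bar>"
    using assms(2) unfolding geodesic_segment_def by metis
  obtain t where t: "t \<in> {0..l}" "p = f t" using f assms(3) by auto
  have "f 0 \<in> A" "f l \<in> A" using f(1) unfolding f(4) by auto
  then have "a \<in> A" "b \<in> A" by (simp_all only: f(2,3))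
  then show ?thesis unfolding between_def
    using f(6)[of 0 t] f(6)[of t l] f(6)[of 0 l] f(1,2,3,5) t assms(3) by auto
qed

text \<open>Hyperbolicity in the form used from here on: stated for points between two vertices rather than
  for points of a chosen side, so that the sides of a triangle need not be named.\<close>

locale thin_geodesic_space = Metric_space M d for M :: "'a set" and d +
  fixes \<delta> :: real
  assumes \<delta>_nonneg: "0 \<le> \<delta>"
    and geodesic: "x \<in> M \<Longrightarrow> y \<in> M \<Longrightarrow> \<exists>c. c 0 = x \<and> c (d x y) = y \<and>
      (\<forall>s\<in>{0..d x y}. between x y (c s)) \<and> (\<forall>s\<in>{0..d x y}. \<forall>t\<in>{0..d x y}. d (c s) (c t) = \<bar>s - t\<bar>)"
    and thin: "between a b x \<Longrightarrow> e \<in> M \<Longrightarrow> \<exists>y. d x y \<le> \<delta> \<and> (between a e y \<or> between e b y)"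

lemma hyperbolic_space_thin:
  assumes "hyperbolic_space M d"
  shows "\<exists>\<delta>. thin_geodesic_space M d \<delta>"
proof -
  have gs: "geodesic_space M d" and MS: "Metric_space M d"
    using assms unfolding hyperbolic_space_def geodesic_space_def by auto
  interpret Metric_space M d by (fact MS)
  obtain \<delta> where \<delta>: "\<delta> \<ge> 0" and thin: "\<And>x y z A B C. geodesic_segment M d x y A \<Longrightarrow>
       geodesic_segment M d y z B \<Longrightarrow> geodesic_segment M d z x C \<Longrightarrow> A \<subseteq> nbhd M d \<delta> (B \<union> C)"
    using assms unfolding hyperbolic_space_def by metis
  have ex: "\<exists>A. geodesic_segment M d x y A" if "x \<in> M" "y \<in> M" for x y
    using gs that unfolding geodesic_space_def by blast
  have "thin_geodesic_space M d \<delta>"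
  proof
    show "0 \<le> \<delta>" by (fact \<delta>)
  next
    fix x y assume xy: "x \<in> M" "y \<in> M"
    obtain A where A: "geodesic_segment M d x y A" using ex xy by blast
    then obtain l c where c: "0 \<le> l" "c 0 = x" "c l = y" "A = c ` {0..l}"
        "\<forall>s\<in>{0..l}. \<forall>t\<in>{0..l}. d (c s) (c t) = \<bar>s - t\<bar>"
      unfolding geodesic_segment_def by metis
    have l: "d x y = l" using c(5)[rule_format, of 0 l] c(1-3) by auto
    show "\<exists>c. c 0 = x \<and> c (d x y) = y \<and> (\<forall>s\<in>{0..d x y}. between x y (c s)) \<and>
        (\<forall>s\<in>{0..d x y}. \<forall>t\<in>{0..d x y}. d (c s) (c t) = \<bar>s - t\<bar>)"
      unfolding l using c geodesic_segment_between[OF MS A] by (intro exI[of _ c]) auto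
  next
    fix a b x e assume btw: "between a b x" and e: "e \<in> M"
    then have M: "a \<in> M" "b \<in> M" "x \<in> M" unfolding between_def by auto
    obtain A1 A2 B C where seg: "geodesic_segment M d a x A1" "geodesic_segment M d x b A2"
        "geodesic_segment M d b e B" "geodesic_segment M d e a C"
      using ex M e by metis
    have A: "geodesic_segment M d a b (A1 \<union> A2)"
      using geodesic_segment_append[OF MS seg(1,2)] btw unfolding between_def by blast
    have "x \<in> A1" using seg(1) unfolding geodesic_segment_def by force
    then obtain y where y: "y \<in> B \<union> C" "d x y \<le> \<delta>"
      using thin[OF A seg(3,4)] unfolding nbhd_def by blast
    then show "\<exists>y. d x y \<le> \<delta> \<and> (between a e y \<or> between e b y)"
      using geodesic_segment_between[OF MS seg(3)] geodesic_segment_between[OF MS seg(4)]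
        between_commute by blast
  qed
  then show ?thesis by blast
qed

context thin_geodesic_space
begin


section \<open>Stability of quasi-geodesics\<close>

text \<open>Divide the path at its midpoint. By the thin triangle with vertices \<open>p i\<close>, \<open>p h\<close>, \<open>p j\<close>, the point
  \<open>x\<close> is \<open>\<delta>\<close>-close to a point between the ends of one of the halves. After \<open>m\<close> halvings, at a total
  cost of \<open>m * \<delta>\<close>, only one step of the path is left.\<close>

lemma near_path_log:
  assumes "i \<le> j" "j - i \<le> 2 ^ m" "between (p i) (p j) x"
    and "\<And>k. i \<le> k \<Longrightarrow> k \<le> j \<Longrightarrow> p k \<in> M"
    and "\<And>k. i \<le> k \<Longrightarrow> k < j \<Longrightarrow> d (p k) (p (Suc k)) \<le> K" and "0 \<le> K"
  shows "\<exists>k. i \<le> k \<and> k \<le> j \<and> d x (p k) \<le> m * \<delta> + K"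
  using assms(1-5)
proof (induction m arbitrary: i j x)
  case 0
  have "d x (p i) \<le> d (p i) (p j)"
    using between_dist_le[OF 0(3)] by (simp add: commute)
  also have "\<dots> \<le> K"
  proof (cases "i = j")
    case True then show ?thesis using 0(4)[of i] \<open>0 \<le> K\<close> by simp
  next
    case False then have "j = Suc i" using 0(1,2) by simp
    then show ?thesis using 0(5)[of i] by simp
  qed
  finally show ?case using 0(1) by auto
next
  case (Suc m)
  define h where "h = (i + j) div 2"
  have h: "i \<le> h" "h \<le> j" "h - i \<le> 2 ^ m" "j - h \<le> 2 ^ m"
    using Suc.prems(1,2) unfolding h_def by auto
  obtain y where y: "d x y \<le> \<delta>" "between (p i) (p h) y \<or> between (p h) (p j) y"
    using thin[OF Suc.prems(3), of "p h"] Suc.prems(4) h by blast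
  have M: "p k \<in> M" if "i \<le> k" "k \<le> j" for k using Suc.prems(4) that by blast
  have step: "d (p k) (p (Suc k)) \<le> K" if "i \<le> k" "k < j" for k using Suc.prems(5) that by blast
  have "\<exists>k. i \<le> k \<and> k \<le> j \<and> d y (p k) \<le> m * \<delta> + K"
    using y(2)
  proof
    assume "between (p i) (p h) y"
    from Suc.IH[OF h(1,3) this M step]
    have "\<exists>k. i \<le> k \<and> k \<le> h \<and> d y (p k) \<le> m * \<delta> + K"
      using h by simp
    then show ?thesis using h(2) by (meson le_trans)
  next
    assume "between (p h) (p j) y"
    from Suc.IH[OF h(2,4) this M step]
    have "\<exists>k. h \<le> k \<and> k \<le> j \<and> d y (p k) \<le> m * \<delta> + K"
      using h by simp
    then show ?thesis using h(1) by (meson le_trans)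
  qed
  then obtain k where k: "i \<le> k" "k \<le> j" "d y (p k) \<le> m * \<delta> + K" by blast
  have "x \<in> M" "y \<in> M" using Suc.prems(3) y(2) unfolding between_def by auto
  then have "d x (p k) \<le> d x y + d y (p k)" using triangle Suc.prems(4) k by blast
  then show ?case using k y by (auto simp: algebra_simps intro!: exI[of _ k])
qed

text \<open>Only discrete paths are considered, and without an additive constant: a geodesic word in one
  finite generating set, read in the word metric of another one, is a path of this kind.\<close>

definition quasi_geodesic :: "real \<Rightarrow> nat \<Rightarrow> (nat \<Rightarrow> 'a) \<Rightarrow> bool" where
  "quasi_geodesic K n p \<longleftrightarrow> (\<forall>i\<le>n. p i \<in> M) \<and>
     (\<forall>i j. i \<le> j \<and> j \<le> n \<longrightarrow> d (p i) (p j) \<le> K * (real j - real i) \<and> real j - real i \<le> K * d (p i) (p j))"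

lemma quasi_geodesic_near_path_ordered:
  assumes "quasi_geodesic K n p" "0 \<le> K" "i \<le> j" "j \<le> n" "between (p i) (p j) x"
  shows "\<exists>k\<le>n. d x (p k) \<le> (log 2 (1 + K * d (p i) (p j)) + 1) * \<delta> + K"
proof -
  define m where "m = nat \<lceil>log 2 (1 + real (j - i))\<rceil>"
  have m: "log 2 (1 + real (j - i)) \<le> m" "m \<le> log 2 (1 + real (j - i)) + 1"
    unfolding m_def using zero_le_log_cancel_iff[of 2 "1 + real (j - i)"] by linarith+
  have "1 + real (j - i) \<le> 2 powr m"
    using m(1) by (subst (asm) log_le_iff) auto
  moreover have "2 powr real m = 2 ^ m" by (simp add: powr_realpow)
  ultimately have "real (j - i) \<le> 2 ^ m" by linarith
  then have "real (j - i) \<le> real (2 ^ m)" unfolding of_nat_power of_nat_numeral .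
  then have le: "j - i \<le> 2 ^ m" by (rule of_nat_le_iff[THEN iffD1])
  have M: "p k \<in> M" if "i \<le> k" "k \<le> j" for k
    using that assms(1,4) unfolding quasi_geodesic_def by auto
  have step: "d (p k) (p (Suc k)) \<le> K" if "i \<le> k" "k < j" for k
  proof -
    have "d (p k) (p (Suc k)) \<le> K * (real (Suc k) - real k)"
      using that assms(1,4) unfolding quasi_geodesic_def by (meson le_SucI le_refl Suc_leI le_trans)
    then show ?thesis by simp
  qed
  obtain k where k: "k \<le> j" "d x (p k) \<le> m * \<delta> + K"
    using near_path_log[OF assms(3) le assms(5) M step assms(2)] by blast
  have "real (j - i) \<le> K * d (p i) (p j)"
    using assms(1,3,4) unfolding quasi_geodesic_def by (simp add: of_nat_diff)
  then have "log 2 (1 + real (j - i)) \<le> log 2 (1 + K * d (p i) (p j))" by simp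
  then have "m * \<delta> \<le> (log 2 (1 + K * d (p i) (p j)) + 1) * \<delta>"
    using m(2) \<delta>_nonneg by (intro mult_right_mono) auto
  then show ?thesis using k assms(4) by (intro exI[of _ k]) auto
qed

text \<open>A quantity bounded by an affine function of its own logarithm is bounded. This is what ends the
  proof that geodesics stay close to quasi-geodesics.\<close>

lemma log_growth_bound:
  assumes "c \<ge> 0"
  shows "\<exists>R\<ge>0. \<forall>D. D \<le> A + (log 2 (1 + c * D) + 1) * \<delta> \<longrightarrow> D \<le> R"
proof -
  have "eventually (\<lambda>D. A + (log 2 (1 + c * D) + 1) * \<delta> < D) at_top"
  proof (cases "c = 0")
    case True then show ?thesis using eventually_gt_at_top[of "A + \<delta>"] by simp
  next
    case False then have "c > 0" using assms by simp
    then show ?thesis by real_asymp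
  qed
  then obtain R where R: "\<And>D. D \<ge> R \<Longrightarrow> A + (log 2 (1 + c * D) + 1) * \<delta> < D"
    unfolding eventually_at_top_linorder by blast
  have "D \<le> max R 0" if "D \<le> A + (log 2 (1 + c * D) + 1) * \<delta>" for D
    using R[of D] that by linarith
  then show ?thesis by (intro exI[of _ "max R 0"]) simp
qed

lemma quasi_geodesic_near_path:
  assumes "quasi_geodesic K n p" "0 \<le> K" "i \<le> n" "j \<le> n" "between (p i) (p j) x"
  shows "\<exists>k\<le>n. d x (p k) \<le> (log 2 (1 + K * d (p i) (p j)) + 1) * \<delta> + K"
proof (cases "i \<le> j")
  case True then show ?thesis using quasi_geodesic_near_path_ordered assms by blast
next
  case False
  then show ?thesis
    using quasi_geodesic_near_path_ordered[of K n p j i x] assms between_commute commute[of "p i" "p j"] by simp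
qed

text \<open>The first half of the Morse lemma. Take a point \<open>x0\<close> between the endpoints whose distance to the
  path is within 1 of the supremum \<open>D\<close> of all these distances. Go from \<open>x0\<close> by \<open>2 * D\<close> (or to the
  endpoint, if it is closer) in both directions, to \<open>y\<close> and \<open>z\<close>, and from there jump to path
  points \<open>p i\<close> and \<open>p j\<close> at distance at most \<open>D\<close>. The quadrilateral \<open>y\<close>, \<open>p i\<close>, \<open>p j\<close>, \<open>z\<close>
  is thin, so \<open>x0\<close> is \<open>2 * \<delta>\<close>-close to one of its other sides. The jumps are at distance at least
  \<open>D - 1\<close> from \<open>x0\<close>, so if one of them is close, \<open>D\<close> is small. Otherwise a point between \<open>p i\<close>
  and \<open>p j\<close> is close; it is within about \<open>\<delta> * log D\<close> of the path, since \<open>p i\<close> and \<open>p j\<close> are at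
  distance at most \<open>6 * D\<close>. As \<open>x0\<close> is at distance at least \<open>D - 1\<close> from the path, \<open>D\<close> is bounded
  by its logarithm, up to constants.\<close>

lemma geodesic_near_quasi_geodesic:
  assumes K: "0 \<le> K"
  shows "\<exists>R\<ge>0. \<forall>n p x. quasi_geodesic K n p \<longrightarrow> between (p 0) (p n) x \<longrightarrow> (\<exists>k\<le>n. d x (p k) \<le> R)"
proof -
  obtain R where R: "R \<ge> 0"
    "\<And>D. D \<le> (1 + K + 2 * \<delta>) + (log 2 (1 + (6 * K) * D) + 1) * \<delta> \<Longrightarrow> D \<le> R"
    using log_growth_bound[of "6 * K" "1 + K + 2 * \<delta>"] K \<delta>_nonneg by auto
  have "\<exists>k\<le>n. d x (p k) \<le> R"
    if qg: "quasi_geodesic K n p" and x: "between (p 0) (p n) x" for n p x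
  proof -
    have M: "p k \<in> M" if "k \<le> n" for k using qg that unfolding quasi_geodesic_def by blast
    define h where "h = (\<lambda>x. Min ((\<lambda>k. d x (p k)) ` {..n}))"
    have h_le: "h x \<le> d x (p k)" if "k \<le> n" for x k
      using that unfolding h_def by (intro Min_le) auto
    have h_attained: "\<exists>k\<le>n. d x (p k) = h x" for x
    proof -
      have "h x \<in> (\<lambda>k. d x (p k)) ` {..n}" unfolding h_def by (intro Min_in) auto
      then show ?thesis by auto
    qed
    define X where "X = {x. between (p 0) (p n) x}"
    define D where "D = (SUP x\<in>X. h x)"
    have "h u \<le> d (p 0) (p n)" if "u \<in> X" for u
      using that between_dist_le[of "p 0" "p n" u] h_le[of 0 u] unfolding X_def
      by (simp add: commute)
    then have bdd: "bdd_above (h ` X)" by (intro bdd_aboveI2)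
    have h_D: "h u \<le> D" if "u \<in> X" for u
      unfolding D_def using that bdd by (intro cSUP_upper)
    have ne: "p 0 \<in> X" using between_left M unfolding X_def by auto
    have D0: "0 \<le> D" using h_D[OF ne] h_attained[of "p 0"] nonneg by (metis order_trans)
    obtain x0 where x0: "x0 \<in> X" "D - 1 < h x0"
      using less_cSUP_iff[of X h "D - 1"] ne bdd unfolding D_def by auto
    have x0M: "x0 \<in> M" and btw0: "between (p 0) (p n) x0"
      using x0 unfolding X_def between_def by auto
    \<comment> \<open>Applied below with \<open>e = 0\<close> and \<open>e = n\<close>, to find \<open>y\<close> with \<open>p i\<close>, and \<open>z\<close> with \<open>p j\<close>.\<close>
    have escape: "\<exists>y i. i \<le> n \<and> between (p e) x0 y \<and> d y (p i) \<le> D \<and> d x0 y \<le> 2 * D \<and>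
        (\<forall>u. between y (p i) u \<longrightarrow> D - 1 \<le> d x0 u)"
      if e: "e \<le> n" and sub: "\<And>y. between (p e) x0 y \<Longrightarrow> y \<in> X" for e
    proof (cases "d x0 (p e) \<le> 2 * D")
      case True
      show ?thesis
        using True e D0 between_left[of "p e" x0] M[OF e] x0M h_le[OF e, of x0] x0(2)
        by (intro exI[of _ "p e"] exI[of _ e]) (auto dest!: between_same)
    next
      case False
      obtain c where c: "c 0 = x0" "\<forall>s\<in>{0..d x0 (p e)}. between x0 (p e) (c s)"
          "\<forall>s\<in>{0..d x0 (p e)}. \<forall>t\<in>{0..d x0 (p e)}. d (c s) (c t) = \<bar>s - t\<bar>"
        using geodesic[OF x0M M[OF e]] by blast
      define y where "y = c (2 * D)"
      have y: "between (p e) x0 y" and dy: "d x0 y = 2 * D"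
        using c(2,3) False D0 between_commute unfolding y_def c(1)[symmetric] by auto
      obtain i where i: "i \<le> n" "d y (p i) \<le> D"
        using h_attained[of y] h_D[OF sub[OF y]] by metis
      have "D - 1 \<le> d x0 u" if u: "between y (p i) u" for u
      proof -
        have "d y u \<le> D" using between_dist_le[OF u] i by linarith
        moreover have "d x0 y \<le> d x0 u + d y u"
          using triangle[of x0 u y] x0M u unfolding between_def by (simp add: commute)
        ultimately show ?thesis using dy by linarith
      qed
      then show ?thesis using y dy i by (intro exI[of _ y] exI[of _ i]) auto
    qed
    obtain y i where y: "i \<le> n" "between (p 0) x0 y" "d y (p i) \<le> D" "d x0 y \<le> 2 * D"
        "\<And>u. between y (p i) u \<Longrightarrow> D - 1 \<le> d x0 u"
      using escape[of 0] between_trans(1)[OF btw0] unfolding X_def by blast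
    obtain z j where z: "j \<le> n" "between (p n) x0 z" "d z (p j) \<le> D" "d x0 z \<le> 2 * D"
        "\<And>u. between z (p j) u \<Longrightarrow> D - 1 \<le> d x0 u"
      using escape[of n] between_trans(1)[of "p n" "p 0" x0] btw0 between_commute
      unfolding X_def by blast
    have yM: "y \<in> M" and zM: "z \<in> M" using y z unfolding between_def by auto
    have btw1: "between y z x0"
      using between_trans(2)[OF btw0 y(2)] between_trans(2)[of "p n" y x0 z] z(2) between_commute by blast
    have pij: "d (p i) (p j) \<le> 6 * D"
    proof -
      have "d (p i) (p j) \<le> d (p i) y + d y (p j)" "d y (p j) \<le> d y z + d z (p j)"
          "d y z \<le> d y x0 + d x0 z"
        using triangle M y(1) z(1) yM zM x0M by blast+
      then show ?thesis using y z commute[of "p i" y] commute[of y x0] by linarith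
    qed
    have "0 \<le> log 2 (1 + (6 * K) * D)" using K D0 by (subst zero_le_log_cancel_iff) (auto intro!: add_pos_nonneg)
    then have log: "0 \<le> (log 2 (1 + (6 * K) * D) + 1) * \<delta>"
      using \<delta>_nonneg by (intro mult_nonneg_nonneg add_nonneg_nonneg) auto
    have "D \<le> (1 + K + 2 * \<delta>) + (log 2 (1 + (6 * K) * D) + 1) * \<delta>"
    proof -
      obtain x1 where x1: "d x0 x1 \<le> \<delta>" "between y (p i) x1 \<or> between (p i) z x1"
        using thin[OF btw1 M[OF y(1)]] by blast
      show ?thesis
        using x1(2)
      proof
        assume "between y (p i) x1"
        then have "D - 1 \<le> \<delta>" using y(5)[of x1] x1(1) by linarith
        then show ?thesis using log K \<delta>_nonneg by linarith
      next
        assume b: "between (p i) z x1"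
        then have x1M: "x1 \<in> M" unfolding between_def by blast
        obtain x2 where x2: "d x1 x2 \<le> \<delta>" "between (p i) (p j) x2 \<or> between (p j) z x2"
          using thin[OF b M[OF z(1)]] by blast
        have x2M: "x2 \<in> M" using x2(2) unfolding between_def by blast
        have d2: "d x0 x2 \<le> 2 * \<delta>" using triangle[OF x0M x1M x2M] x1(1) x2(1) by linarith
        show ?thesis
          using x2(2)
        proof
          assume "between (p j) z x2"
          then have "D - 1 \<le> 2 * \<delta>" using z(5)[of x2] d2 between_commute by fastforce
          then show ?thesis using log K \<delta>_nonneg by linarith
        next
          assume "between (p i) (p j) x2"
          then obtain k where k: "k \<le> n" "d x2 (p k) \<le> (log 2 (1 + K * d (p i) (p j)) + 1) * \<delta> + K"
            using quasi_geodesic_near_path[OF qg K y(1) z(1)] by blast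
          have "K * d (p i) (p j) \<le> 6 * K * D" using mult_left_mono[OF pij K] by simp
          then have "(log 2 (1 + K * d (p i) (p j)) + 1) * \<delta> \<le> (log 2 (1 + (6 * K) * D) + 1) * \<delta>"
            using K \<delta>_nonneg nonneg[of "p i" "p j"]
            by (intro mult_right_mono add_right_mono log_mono) (auto intro!: add_pos_nonneg)
          moreover have "D - 1 \<le> d x0 (p k)" using x0(2) h_le[OF k(1), of x0] by linarith
          moreover have "d x0 (p k) \<le> d x0 x2 + d x2 (p k)" using triangle x0M x2M M[OF k(1)] by blast
          ultimately show ?thesis using k(2) d2 by linarith
        qed
      qed
    qed
    then have "D \<le> R" by (rule R(2))
    moreover have "h x \<le> D" using x h_D unfolding X_def by blast
    ultimately show ?thesis using h_attained[of x] by (metis order_trans)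
  qed
  then show ?thesis using R(1) by blast
qed

text \<open>The second half of the Morse lemma, by a discrete connectedness argument. Walk along a geodesic
  from \<open>p 0\<close> to \<open>p n\<close> in steps of length at most 1. Each point on the way is \<open>R\<close>-close to some
  path point, of index at most \<open>i\<close> at the start and at least \<open>i\<close> at the end. Where the index
  first reaches \<open>i\<close>, two indices \<open>k \<le> i \<le> k'\<close> have path points at distance at most \<open>2 * R + 1\<close>, so
  \<open>k' - k\<close> is bounded by the quasi-geodesic inequality, and \<open>p i\<close> is close to \<open>p k\<close>, hence to the
  geodesic.\<close>

lemma quasi_geodesic_near_geodesic:
  assumes K: "0 \<le> K"
  shows "\<exists>R. \<forall>n p i. quasi_geodesic K n p \<longrightarrow> i \<le> n \<longrightarrow> (\<exists>x. between (p 0) (p n) x \<and> d (p i) x \<le> R)"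
proof -
  obtain R where R: "R \<ge> 0" "\<And>n p x. quasi_geodesic K n p \<Longrightarrow> between (p 0) (p n) x \<Longrightarrow> \<exists>k\<le>n. d x (p k) \<le> R"
    using geodesic_near_quasi_geodesic[OF K] by blast
  have "\<exists>x. between (p 0) (p n) x \<and> d (p i) x \<le> K * (K * (2 * R + 1)) + R"
    if qg: "quasi_geodesic K n p" and i: "i \<le> n" for n p i
  proof -
    have M: "p k \<in> M" if "k \<le> n" for k using qg that unfolding quasi_geodesic_def by blast
    define l where "l = d (p 0) (p n)"
    obtain c where c: "c 0 = p 0" "c l = p n" "\<forall>s\<in>{0..l}. between (p 0) (p n) (c s)"
        "\<forall>s\<in>{0..l}. \<forall>t\<in>{0..l}. d (c s) (c t) = \<bar>s - t\<bar>"
      using geodesic[OF M M, of 0 n] unfolding l_def by auto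
    have l0: "0 \<le> l" unfolding l_def by simp
    define g where "g = (\<lambda>t::nat. c (min (real t) l))"
    have g: "between (p 0) (p n) (g t)" for t using c(3) l0 unfolding g_def by auto
    have gM: "g t \<in> M" for t using g unfolding between_def by blast
    have step: "d (g t) (g (Suc t)) \<le> 1" for t using c(4) l0 unfolding g_def by (auto simp: min_def)
    define far where "far = (\<lambda>t. \<exists>k. i \<le> k \<and> k \<le> n \<and> d (g t) (p k) \<le> R)"
    have "far (nat \<lceil>l\<rceil>)"
    proof -
      have "g (nat \<lceil>l\<rceil>) = p n" unfolding g_def using c(2) real_nat_ceiling_ge[of l] by (simp add: min_absorb2)
      then show ?thesis using i R(1) M[of n] unfolding far_def by (intro exI[of _ n]) auto
    qed
    define t where "t = (LEAST t. far t)"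
    have t: "far t" "\<And>s. s < t \<Longrightarrow> \<not> far s"
      unfolding t_def using LeastI[of far] not_less_Least[of _ far] \<open>far (nat \<lceil>l\<rceil>)\<close> by blast+
    obtain k' where k': "i \<le> k'" "k' \<le> n" "d (g t) (p k') \<le> R" using t(1) unfolding far_def by blast
    obtain s k where k: "k \<le> i" "d (g s) (p k) \<le> R" "d (g s) (g t) \<le> 1"
    proof (cases t)
      case 0
      have "g t = p 0" using 0 l0 c(1) unfolding g_def by simp
      then show ?thesis using that[of 0 t] R(1) M[of 0] by simp
    next
      case (Suc s)
      obtain k where "k \<le> n" "d (g s) (p k) \<le> R" using R(2)[OF qg g] by blast
      moreover have "k < i" using t(2)[of s] Suc calculation unfolding far_def by (meson lessI not_le_imp_less)
      ultimately show ?thesis using that[of k s] step[of s] Suc by simp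
    qed
    have kn: "k \<le> n" using k i by simp
    have "d (p k) (p k') \<le> 2 * R + 1"
    proof -
      have "d (p k) (p k') \<le> d (p k) (g s) + d (g s) (p k')" "d (g s) (p k') \<le> d (g s) (g t) + d (g t) (p k')"
        using triangle M kn k'(2) gM by blast+
      then show ?thesis using k k' commute[of "p k" "g s"] by linarith
    qed
    then have "real k' - real k \<le> K * (2 * R + 1)"
      using qg k(1) k'(1,2) mult_left_mono[OF _ K] unfolding quasi_geodesic_def by (meson order_trans)
    then have "real i - real k \<le> K * (2 * R + 1)" using k'(1) by simp
    then have "d (p k) (p i) \<le> K * (K * (2 * R + 1))"
      using qg k(1) i mult_left_mono[OF _ K] unfolding quasi_geodesic_def by (meson order_trans)
    then have "d (p i) (g s) \<le> K * (K * (2 * R + 1)) + R"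
      using triangle[of "p i" "p k" "g s"] M kn i gM k(2) by (simp add: commute)
    then show ?thesis using g by blast
  qed
  then show ?thesis by blast
qed

text \<open>Triangles with quasi-geodesic sides are thin: go from a side to the geodesic with the same
  endpoints, from there to another side of the geodesic triangle, and back to the quasi-geodesic.\<close>

lemma thin_quasi_triangles:
  assumes K: "0 \<le> K"
  shows "\<exists>R. \<forall>n p m q l r i. quasi_geodesic K n p \<longrightarrow> quasi_geodesic K m q \<longrightarrow> quasi_geodesic K l r \<longrightarrow>
    p 0 = q 0 \<longrightarrow> q m = r 0 \<longrightarrow> p n = r l \<longrightarrow> i \<le> n \<longrightarrow>
    (\<exists>j\<le>m. d (p i) (q j) \<le> R) \<or> (\<exists>j\<le>l. d (p i) (r j) \<le> R)"
proof -
  obtain R1 where R1: "\<And>n p x. quasi_geodesic K n p \<Longrightarrow> between (p 0) (p n) x \<Longrightarrow> \<exists>k\<le>n. d x (p k) \<le> R1"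
    using geodesic_near_quasi_geodesic[OF K] by blast
  obtain R2 where R2: "\<And>n p i. quasi_geodesic K n p \<Longrightarrow> i \<le> n \<Longrightarrow> \<exists>x. between (p 0) (p n) x \<and> d (p i) x \<le> R2"
    using quasi_geodesic_near_geodesic[OF K] by blast
  have "(\<exists>j\<le>m. d (p i) (q j) \<le> R2 + \<delta> + R1) \<or> (\<exists>j\<le>l. d (p i) (r j) \<le> R2 + \<delta> + R1)"
    if qg: "quasi_geodesic K n p" "quasi_geodesic K m q" "quasi_geodesic K l r"
      and ends: "p 0 = q 0" "q m = r 0" "p n = r l" and i: "i \<le> n" for n p m q l r i
  proof -
    have M: "p i \<in> M" "q m \<in> M" "\<And>j. j \<le> m \<Longrightarrow> q j \<in> M" "\<And>j. j \<le> l \<Longrightarrow> r j \<in> M"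
      using qg i unfolding quasi_geodesic_def by auto
    obtain x where x: "between (p 0) (p n) x" "d (p i) x \<le> R2" using R2 qg(1) i by blast
    obtain y where y: "d x y \<le> \<delta>" "between (q 0) (q m) y \<or> between (r 0) (r l) y"
      using thin[OF x(1) M(2)] ends by auto
    have xM: "x \<in> M" "y \<in> M" using x y unfolding between_def by auto
    have near: "d (p i) z \<le> R2 + \<delta> + R1" if "z \<in> M" "d y z \<le> R1" for z
    proof -
      have "d (p i) z \<le> d (p i) x + d x z" "d x z \<le> d x y + d y z"
        using triangle M(1) xM that(1) by blast+
      then show ?thesis using x(2) y(1) that(2) by linarith
    qed
    show ?thesis using y(2) R1[OF qg(2)] R1[OF qg(3)] near M(3,4) by meson
  qed
  then show ?thesis by blast
qed

end


section \<open>Distances of vertices in the Cayley graph\<close>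

definition vertex :: "'g \<Rightarrow> 'g \<Rightarrow> real" where
  "vertex g = indicator {g}"

text \<open>The piecewise linear extension to the Cayley graph of a function on its vertices.\<close>

definition barycentric :: "('g \<Rightarrow> real) \<Rightarrow> ('g \<Rightarrow> real) \<Rightarrow> real" where
  "barycentric f p = (\<Sum>x | p x \<noteq> 0. p x * f x)"

lemma barycentric_vertex: "barycentric f (vertex g) = f g"
proof -
  have "{x. vertex g x \<noteq> 0} = {g}" by (auto simp: vertex_def indicator_def)
  then show ?thesis by (simp add: barycentric_def vertex_def)
qed

lemma finite_cayley_cell: "C \<in> cayley_cells S \<Longrightarrow> finite C"
  unfolding cayley_cells_def by auto

lemma barycentric_cell:
  assumes "C \<in> cayley_cells S" "p \<in> cell_points C"
  shows "barycentric f p = (\<Sum>x\<in>C. p x * f x)"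
  unfolding barycentric_def
  using assms finite_cayley_cell[OF assms(1)] unfolding cell_points_def
  by (intro sum.mono_neutral_left) auto

text \<open>The extension is affine on an edge \<open>{g, h}\<close>, and half of the \<open>\<ell>\<^sup>1\<close>-distance of two points of the
  edge is \<open>\<bar>p g - q g\<bar>\<close>, the length of the piece between them; so a Lipschitz constant on vertices is
  one on the edge.\<close>

lemma barycentric_cell_diff:
  assumes C: "C \<in> cayley_cells S" and p: "p \<in> cell_points C" and q: "q \<in> cell_points C"
    and f: "\<And>g s. s \<in> S \<Longrightarrow> \<bar>f g - f (g + s)\<bar> \<le> K"
  shows "\<bar>barycentric f p - barycentric f q\<bar> \<le> K * ((\<Sum>x\<in>C. \<bar>p x - q x\<bar>) / 2)"
proof (cases "\<exists>g. C = {g}")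
  case True
  then show ?thesis
    using p q barycentric_cell[OF C p, of f] barycentric_cell[OF C q, of f] unfolding cell_points_def by auto
next
  case False
  then obtain g s where gs: "C = {g, g + s}" "s \<in> S" "g \<noteq> g + s"
    using C unfolding cayley_cells_def by (auto 0 3)
  define h where "h = g + s"
  have gh: "g \<noteq> h" and Ch: "C = {g, h}" and fgh: "\<bar>f g - f h\<bar> \<le> K"
    using gs f unfolding h_def by auto
  have sums: "p g + p h = 1" "q g + q h = 1"
    using p q gh unfolding Ch cell_points_def by auto
  define t where "t = p g - q g"
  have th: "p h - q h = - t" using sums unfolding t_def by linarith
  have "barycentric f p - barycentric f q = t * f g + (p h - q h) * f h"
    using gh unfolding barycentric_cell[OF C p] barycentric_cell[OF C q] Ch t_def
    by (simp add: algebra_simps)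
  also have "\<dots> = t * (f g - f h)" unfolding th by (simp add: algebra_simps)
  finally have "\<bar>barycentric f p - barycentric f q\<bar> = \<bar>t\<bar> * \<bar>f g - f h\<bar>" by (simp add: abs_mult)
  also have "\<dots> \<le> \<bar>t\<bar> * K" using fgh by (intro mult_left_mono) auto
  also have "\<bar>t\<bar> = (\<Sum>x\<in>C. \<bar>p x - q x\<bar>) / 2" using gh th unfolding Ch t_def by simp
  finally show ?thesis by (simp add: mult.commute)
qed

lemma cayley_path_barycentric:
  assumes "cayley_path S p q l" and f: "\<And>g s. s \<in> S \<Longrightarrow> \<bar>f g - f (g + s)\<bar> \<le> K"
  shows "\<bar>barycentric f p - barycentric f q\<bar> \<le> K * l"
  using assms(1)
proof (induction rule: cayley_path.induct)
  case (refl p)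
  then show ?case by simp
next
  case (step C p q r l)
  have "\<bar>barycentric f p - barycentric f q\<bar> \<le> K * ((\<Sum>x\<in>C. \<bar>p x - q x\<bar>) / 2)"
    using step f by (intro barycentric_cell_diff)
  then show ?case using step.IH distrib_left[of K "(\<Sum>x\<in>C. \<bar>p x - q x\<bar>) / 2" l] by linarith
qed

lemma cayley_path_nonneg: "cayley_path S p q l \<Longrightarrow> 0 \<le> l"
  by (induction rule: cayley_path.induct) (auto intro!: add_nonneg_nonneg sum_nonneg)

lemma vertex_in_cayley_points: "vertex g \<in> cayley_points S"
  unfolding cayley_points_def cayley_cells_def cell_points_def vertex_def
  by (intro UN_I[of "{g}"]) (auto simp: indicator_def)

lemma cayley_path_word:
  assumes "set w \<subseteq> S"
  shows "\<exists>l\<le>real (length w). cayley_path S (vertex g) (vertex (g + sum_list w)) l"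
  using assms
proof (induction w arbitrary: g)
  case Nil
  have "cayley_path S (vertex g) (vertex g) 0"
    by (intro cayley_path.refl vertex_in_cayley_points)
  then show ?case by (intro exI[of _ 0]) simp
next
  case (Cons s w)
  obtain l where l: "l \<le> real (length w)" "cayley_path S (vertex (g + s)) (vertex (g + s + sum_list w)) l"
    using Cons.IH[of "g + s"] Cons.prems by auto
  define C where "C = {g, g + s}"
  have "C \<in> cayley_cells S" using Cons.prems unfolding C_def cayley_cells_def by auto
  moreover have "vertex g \<in> cell_points C" "vertex (g + s) \<in> cell_points C"
    unfolding C_def cell_points_def vertex_def by (auto simp: indicator_def sum.insert_if)
  ultimately have path: "cayley_path S (vertex g) (vertex (g + s + sum_list w))
      ((\<Sum>x\<in>C. \<bar>vertex g x - vertex (g + s) x\<bar>) / 2 + l)"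
    using l(2) by (rule cayley_path.step)
  have "(\<Sum>x\<in>C. \<bar>vertex g x - vertex (g + s) x\<bar>) / 2 \<le> 1"
    unfolding C_def vertex_def by (auto simp: indicator_def sum.insert_if)
  then show ?case
    using l(1) path by (intro exI[of _ "(\<Sum>x\<in>C. \<bar>vertex g x - vertex (g + s) x\<bar>) / 2 + l"]) (auto simp: add.assoc)
qed

lemma cayley_dist_vertex_le:
  assumes "set w \<subseteq> S"
  shows "cayley_dist S (vertex g) (vertex (g + sum_list w)) \<le> length w"
proof -
  obtain l where l: "l \<le> real (length w)" "cayley_path S (vertex g) (vertex (g + sum_list w)) l"
    using cayley_path_word[OF assms] by blast
  have "bdd_below {l. cayley_path S (vertex g) (vertex (g + sum_list w)) l}"
    using cayley_path_nonneg by (intro bdd_belowI[of _ 0]) auto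
  then have "cayley_dist S (vertex g) (vertex (g + sum_list w)) \<le> l"
    unfolding cayley_dist_def using l(2) vertex_in_cayley_points[of _ S] by (simp add: cInf_lower)
  then show ?thesis using l(1) by linarith
qed

lemma symmetric_generating_word:
  assumes "finite_symmetric_generating S"
  obtains w where "set w \<subseteq> S" "sum_list w = g"
  using assms unfolding finite_symmetric_generating_def generating_def by (metis Un_absorb)

text \<open>A path in the Cayley graph may turn round inside edges, so its length cannot be read off a word.
  But a function on the vertices that changes by at most \<open>K\<close> along each edge has a \<open>K\<close>-Lipschitz
  extension to the whole graph, and this bounds all path lengths from below.\<close>

lemma cayley_dist_vertex_ge:
  assumes S: "finite_symmetric_generating S"
    and f: "\<And>g s. s \<in> S \<Longrightarrow> \<bar>f g - f (g + s)\<bar> \<le> K" and K: "0 < K"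
  shows "\<bar>f a - f b\<bar> \<le> K * cayley_dist S (vertex a) (vertex b)"
proof -
  obtain w where w: "set w \<subseteq> S" "sum_list w = - a + b" using symmetric_generating_word[OF S] .
  have ne: "{l. cayley_path S (vertex a) (vertex b) l} \<noteq> {}"
    using cayley_path_word[OF w(1), of a] w(2) by (auto simp: add.assoc[symmetric])
  have "\<bar>f a - f b\<bar> / K \<le> Inf {l. cayley_path S (vertex a) (vertex b) l}"
  proof (rule cInf_greatest[OF ne])
    fix l assume "l \<in> {l. cayley_path S (vertex a) (vertex b) l}"
    then show "\<bar>f a - f b\<bar> / K \<le> l"
      using cayley_path_barycentric[of S "vertex a" "vertex b" l f K] f K
      by (simp add: barycentric_vertex pos_divide_le_eq mult.commute)
  qed
  then show ?thesis
    unfolding cayley_dist_def using K vertex_in_cayley_points[of _ S]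
    by (simp add: pos_divide_le_eq mult.commute)
qed


section \<open>Minimal presentations form thin triangles\<close>

definition prefixes :: "('g::group_add \<Rightarrow> 'g list) \<Rightarrow> 'g \<Rightarrow> 'g set" where
  "prefixes \<sigma> g = (\<lambda>i. sum_list (take i (\<sigma> g))) ` {..length (\<sigma> g)}"

lemma minimal_presentation_length_le:
  assumes "minimal_presentation S \<sigma>" "set w \<subseteq> S"
  shows "length (\<sigma> (sum_list w)) \<le> length w"
  using assms unfolding minimal_presentation_def by blast

lemma minimal_presentation_length_zero:
  assumes "minimal_presentation S \<sigma>"
  shows "\<sigma> 0 = []"
  using minimal_presentation_length_le[OF assms, of "[]"] by simp

lemma minimal_presentation_length_add:
  assumes "minimal_presentation S \<sigma>"
  shows "length (\<sigma> (g + h)) \<le> length (\<sigma> g) + length (\<sigma> h)"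
proof -
  have "set (\<sigma> g @ \<sigma> h) \<subseteq> S" "sum_list (\<sigma> g @ \<sigma> h) = g + h"
    using assms unfolding minimal_presentation_def by auto
  then show ?thesis using minimal_presentation_length_le[OF assms, of "\<sigma> g @ \<sigma> h"] by simp
qed

text \<open>Subwords of a minimal word have minimal length, as replacing one by a shorter word would shorten
  the whole word. So the prefixes of a minimal word form a geodesic in the word metric.\<close>

lemma minimal_presentation_subword:
  assumes \<sigma>: "minimal_presentation S \<sigma>" and ij: "i \<le> j" "j \<le> length (\<sigma> g)"
  shows "length (\<sigma> (- sum_list (take i (\<sigma> g)) + sum_list (take j (\<sigma> g)))) = j - i"
proof -
  define u where "u = take i (\<sigma> g)"
  define v where "v = take (j - i) (drop i (\<sigma> g))"
  define w where "w = drop j (\<sigma> g)"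
  have take_j: "take j (\<sigma> g) = u @ v"
    using ij(1) unfolding u_def v_def by (metis le_add_diff_inverse take_add)
  have split: "\<sigma> g = u @ v @ w" unfolding w_def using take_j by (metis append.assoc append_take_drop_id)
  have len: "length v = j - i" using ij unfolding v_def by simp
  have S: "set (\<sigma> g) \<subseteq> S" "sum_list (\<sigma> g) = g" "\<And>h. set (\<sigma> h) \<subseteq> S" "\<And>h. sum_list (\<sigma> h) = h"
    using \<sigma> unfolding minimal_presentation_def by auto
  have diff: "- sum_list (take i (\<sigma> g)) + sum_list (take j (\<sigma> g)) = sum_list v"
    unfolding take_j unfolding u_def by (simp add: add.assoc[symmetric])
  have le: "length (\<sigma> (sum_list v)) \<le> length v"
    using S(1) split by (intro minimal_presentation_length_le[OF \<sigma>]) auto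
  have "length (\<sigma> g) \<le> length (u @ \<sigma> (sum_list v) @ w)"
  proof -
    have "set (u @ \<sigma> (sum_list v) @ w) \<subseteq> S" using S split by (metis Un_subset_iff set_append)
    moreover have "sum_list (u @ \<sigma> (sum_list v) @ w) = g"
      using S(2,4) arg_cong[OF split, of sum_list] by simp
    ultimately show ?thesis using \<sigma> unfolding minimal_presentation_def by blast
  qed
  moreover have "length (\<sigma> g) = length u + length v + length w" using arg_cong[OF split, of length] by simp
  ultimately show ?thesis using le len unfolding diff by simp
qed

text \<open>To be applied with two finite generating sets, \<open>K\<close> bounding the length of the letters of one of them in
  terms of the other.\<close>

lemma translate_words:
  assumes "\<And>s. s \<in> S \<Longrightarrow> \<exists>v. set v \<subseteq> T \<and> sum_list v = s \<and> length v \<le> K" "set w \<subseteq> S"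
  shows "\<exists>v. set v \<subseteq> T \<and> sum_list v = sum_list w \<and> length v \<le> K * length w"
  using assms(2)
proof (induction w)
  case Nil
  show ?case by (intro exI[of _ "[]"]) simp
next
  case (Cons s w)
  obtain u where u: "set u \<subseteq> T" "sum_list u = s" "length u \<le> K" using assms(1) Cons.prems by auto
  obtain v where v: "set v \<subseteq> T" "sum_list v = sum_list w" "length v \<le> K * length w"
    using Cons by auto
  show ?case using u v by (intro exI[of _ "u @ v"]) simp
qed

lemma finite_word_ball:
  assumes "finite S" "minimal_presentation S \<sigma>"
  shows "finite {g. length (\<sigma> g) \<le> n}"
proof (rule finite_subset)
  show "{g. length (\<sigma> g) \<le> n} \<subseteq> sum_list ` {w. set w \<subseteq> S \<and> length w \<le> n}"
  proof
    fix g assume "g \<in> {g. length (\<sigma> g) \<le> n}"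
    then show "g \<in> sum_list ` {w. set w \<subseteq> S \<and> length w \<le> n}"
      using assms(2) unfolding minimal_presentation_def by (intro image_eqI[of _ _ "\<sigma> g"]) auto
  qed
  show "finite (sum_list ` {w. set w \<subseteq> S \<and> length w \<le> n})"
    using assms(1) by (intro finite_imageI finite_lists_length_le)
qed

text \<open>The upper bound on the distance rewrites a minimal word over \<open>S\<close> in the letters of \<open>T\<close>. The lower
  bound holds because the word length over \<open>S\<close> of \<open>- a + g\<close> changes by at most \<open>K\<close> when \<open>g\<close> moves
  along an edge of the Cayley graph of \<open>T\<close>.\<close>

lemma word_length_bilipschitz:
  assumes T: "finite_symmetric_generating T" and S: "finite_symmetric_generating S"
    and \<sigma>: "minimal_presentation S \<sigma>"
  shows "\<exists>K::real. 0 \<le> K \<and> (\<forall>a b. cayley_dist T (vertex a) (vertex b) \<le> K * length (\<sigma> (- a + b)) \<and>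
     length (\<sigma> (- a + b)) \<le> K * cayley_dist T (vertex a) (vertex b))"
proof -
  have \<sigma>': "set (\<sigma> g) \<subseteq> S" "sum_list (\<sigma> g) = g" for g
    using \<sigma> unfolding minimal_presentation_def by auto
  have fin: "finite S" "finite T" using S T unfolding finite_symmetric_generating_def by auto
  define \<tau> where "\<tau> = (\<lambda>g. SOME w. set w \<subseteq> T \<and> sum_list w = g)"
  have \<tau>: "set (\<tau> g) \<subseteq> T \<and> sum_list (\<tau> g) = g" for g
    unfolding \<tau>_def using symmetric_generating_word[OF T, of g]
    by (intro someI_ex[of "\<lambda>w. set w \<subseteq> T \<and> sum_list w = g"]) metis
  define K where "K = Suc ((\<Sum>s\<in>S. length (\<tau> s)) + (\<Sum>t\<in>T. length (\<sigma> t)))"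
  have KS: "length (\<tau> s) \<le> K" if "s \<in> S" for s
    using member_le_sum[OF that, of "\<lambda>s. length (\<tau> s)"] fin unfolding K_def by simp
  have KT: "length (\<sigma> t) \<le> K" if "t \<in> T" for t
    using member_le_sum[OF that, of "\<lambda>s. length (\<sigma> s)"] fin unfolding K_def by simp
  have "cayley_dist T (vertex a) (vertex b) \<le> K * length (\<sigma> (- a + b))" for a b
  proof -
    have "\<exists>v. set v \<subseteq> T \<and> sum_list v = s \<and> length v \<le> K" if "s \<in> S" for s
      using KS[OF that] \<tau> by blast
    from translate_words[OF this \<sigma>'(1)]
    obtain w where w: "set w \<subseteq> T" "sum_list w = - a + b" "length w \<le> K * length (\<sigma> (- a + b))"
      unfolding \<sigma>'(2) by blast
    have "cayley_dist T (vertex a) (vertex (a + sum_list w)) \<le> length w"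
      by (rule cayley_dist_vertex_le[OF w(1)])
    also have "a + sum_list w = b" unfolding w(2) by (simp add: add.assoc[symmetric])
    also have "real (length w) \<le> K * length (\<sigma> (- a + b))"
      using w(3) unfolding of_nat_mult[symmetric] by (rule of_nat_mono)
    finally show ?thesis .
  qed
  moreover have "length (\<sigma> (- a + b)) \<le> K * cayley_dist T (vertex a) (vertex b)" for a b
  proof -
    define f where "f = (\<lambda>g. real (length (\<sigma> (- a + g))))"
    have "\<bar>f g - f (g + t)\<bar> \<le> K" if t: "t \<in> T" for g t
    proof -
      have "- t \<in> T" using t T unfolding finite_symmetric_generating_def by blast
      then have "length (\<sigma> (- t)) \<le> K" by (rule KT)
      moreover have "length (\<sigma> (- a + g)) \<le> length (\<sigma> (- a + (g + t))) + length (\<sigma> (- t))"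
        using minimal_presentation_length_add[OF \<sigma>, of "- a + (g + t)" "- t"]
        by (simp add: add.assoc del: add_uminus_conv_diff)
      moreover have "length (\<sigma> (- a + (g + t))) \<le> length (\<sigma> (- a + g)) + length (\<sigma> t)"
        using minimal_presentation_length_add[OF \<sigma>, of "- a + g" t] by (simp add: add.assoc)
      ultimately show ?thesis using KT[OF t] unfolding f_def by linarith
    qed
    moreover have "0 < real K" unfolding K_def by (simp only: of_nat_0_less_iff zero_less_Suc)
    ultimately have "\<bar>f a - f b\<bar> \<le> K * cayley_dist T (vertex a) (vertex b)"
      by (rule cayley_dist_vertex_ge[OF T])
    then show ?thesis unfolding f_def using minimal_presentation_length_zero[OF \<sigma>] by simp
  qed
  ultimately show ?thesis by (intro exI[of _ "real K"]) auto
qed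

text \<open>Hyperbolicity is given for the Cayley graph of some generating set \<open>T\<close>, where minimal words over
  \<open>S\<close> are only quasi-geodesics, uniformly. The minimal words of \<open>g + h\<close> and \<open>g\<close>, read from the unit,
  and that of \<open>h\<close>, read from \<open>g\<close>, form a thin quasi-triangle. The element \<open>r\<close> is the
  displacement from a point of one of the other two sides to \<open>x\<close>.\<close>

lemma minimal_presentation_thin_triangles:
  fixes S :: "'g::group_add set"
  assumes hyp: "word_hyperbolic TYPE('g)" and S: "finite_symmetric_generating S"
    and \<sigma>: "minimal_presentation S \<sigma>"
  shows "\<exists>B. finite B \<and> (\<forall>g h. \<forall>x\<in>prefixes \<sigma> (g + h). \<exists>r\<in>B.
    x - r \<in> prefixes \<sigma> g \<or> - g + x - r \<in> prefixes \<sigma> h)"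
proof -
  obtain T :: "'g set" where T: "finite_symmetric_generating T"
      "hyperbolic_space (cayley_points T) (cayley_dist T)"
    using hyp unfolding word_hyperbolic_def by blast
  obtain \<delta> where "thin_geodesic_space (cayley_points T) (cayley_dist T) \<delta>"
    using hyperbolic_space_thin[OF T(2)] by blast
  then interpret thin_geodesic_space "cayley_points T" "cayley_dist T" \<delta> .
  obtain K :: real where K: "0 \<le> K"
      "\<And>a b. cayley_dist T (vertex a) (vertex b) \<le> K * length (\<sigma> (- a + b))"
      "\<And>a b. length (\<sigma> (- a + b)) \<le> K * cayley_dist T (vertex a) (vertex b)"
    using word_length_bilipschitz[OF T(1) S \<sigma>] by metis
  define ray where "ray = (\<lambda>a g i. vertex (a + sum_list (take i (\<sigma> g))))"
  have sum_\<sigma>: "sum_list (\<sigma> g) = g" for g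
    using \<sigma> unfolding minimal_presentation_def by blast
  have qg: "quasi_geodesic K (length (\<sigma> g)) (ray a g)" for a g
  proof -
    have len: "length (\<sigma> (- (a + sum_list (take i (\<sigma> g))) + (a + sum_list (take j (\<sigma> g))))) = j - i"
      if "i \<le> j" "j \<le> length (\<sigma> g)" for i j
      using minimal_presentation_subword[OF \<sigma> that] by (simp add: minus_add add.assoc del: add_uminus_conv_diff)
    show ?thesis
      unfolding quasi_geodesic_def
    proof (intro conjI allI impI)
      show "ray a g i \<in> cayley_points T" for i unfolding ray_def by (rule vertex_in_cayley_points)
    next
      fix i j assume ij: "i \<le> j \<and> j \<le> length (\<sigma> g)"
      show "cayley_dist T (ray a g i) (ray a g j) \<le> K * (real j - real i)"
        using K(2)[of "a + sum_list (take i (\<sigma> g))" "a + sum_list (take j (\<sigma> g))"] len[of i j] ij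
        unfolding ray_def by (simp add: of_nat_diff)
      show "real j - real i \<le> K * cayley_dist T (ray a g i) (ray a g j)"
        using K(3)[of "a + sum_list (take i (\<sigma> g))" "a + sum_list (take j (\<sigma> g))"] len[of i j] ij
        unfolding ray_def by (simp add: of_nat_diff)
    qed
  qed
  obtain R where R: "\<And>n p m q l r i. quasi_geodesic K n p \<Longrightarrow> quasi_geodesic K m q \<Longrightarrow> quasi_geodesic K l r \<Longrightarrow>
      p 0 = q 0 \<Longrightarrow> q m = r 0 \<Longrightarrow> p n = r l \<Longrightarrow> i \<le> n \<Longrightarrow>
      (\<exists>j\<le>m. cayley_dist T (p i) (q j) \<le> R) \<or> (\<exists>j\<le>l. cayley_dist T (p i) (r j) \<le> R)"
    using thin_quasi_triangles[OF K(1)] by metis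
  define B where "B = {r. length (\<sigma> r) \<le> nat \<lfloor>K * R\<rfloor>}"
  have B: "- y + x \<in> B" if "cayley_dist T (vertex x) (vertex y) \<le> R" for x y
  proof -
    have "length (\<sigma> (- y + x)) \<le> K * R"
      using K(3)[of y x] mult_left_mono[OF that K(1)]
      unfolding commute[of "vertex x" "vertex y"] by linarith
    then show ?thesis unfolding B_def by (simp add: le_nat_floor)
  qed
  have "finite B"
    unfolding B_def using S \<sigma> unfolding finite_symmetric_generating_def by (intro finite_word_ball) auto
  moreover have "\<exists>r\<in>B. x - r \<in> prefixes \<sigma> g \<or> - g + x - r \<in> prefixes \<sigma> h"
    if x: "x \<in> prefixes \<sigma> (g + h)" for g h x
  proof -
    obtain i where i: "i \<le> length (\<sigma> (g + h))" "x = sum_list (take i (\<sigma> (g + h)))"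
      using x unfolding prefixes_def by auto
    have px: "ray 0 (g + h) i = vertex x" unfolding ray_def i(2) by simp
    have cancel: "x - (- y + x) = y" for y :: 'g
      by (simp only: diff_conv_add_uminus minus_add minus_minus add.assoc add_minus_cancel minus_add_cancel)
    have "(\<exists>j\<le>length (\<sigma> g). cayley_dist T (ray 0 (g + h) i) (ray 0 g j) \<le> R) \<or>
        (\<exists>j\<le>length (\<sigma> h). cayley_dist T (ray 0 (g + h) i) (ray g h j) \<le> R)"
      by (rule R[OF qg qg qg]) (use i(1) in \<open>simp_all add: ray_def sum_\<sigma>\<close>)
    then show ?thesis
    proof
      assume "\<exists>j\<le>length (\<sigma> g). cayley_dist T (ray 0 (g + h) i) (ray 0 g j) \<le> R"
      then obtain j where j: "j \<le> length (\<sigma> g)" "cayley_dist T (vertex x) (ray 0 g j) \<le> R"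
        unfolding px by blast
      define y where "y = sum_list (take j (\<sigma> g))"
      have "- y + x \<in> B" using j(2) B unfolding ray_def y_def by simp
      moreover have "x - (- y + x) \<in> prefixes \<sigma> g"
        unfolding cancel y_def prefixes_def using j(1) by blast
      ultimately show ?thesis by blast
    next
      assume "\<exists>j\<le>length (\<sigma> h). cayley_dist T (ray 0 (g + h) i) (ray g h j) \<le> R"
      then obtain j where j: "j \<le> length (\<sigma> h)" "cayley_dist T (vertex x) (ray g h j) \<le> R"
        unfolding px by blast
      define y where "y = sum_list (take j (\<sigma> h))"
      have "- (g + y) + x \<in> B" using j(2) B unfolding ray_def y_def by simp
      moreover have "- g + x - (- (g + y) + x) = y"
        by (simp only: diff_conv_add_uminus minus_add minus_minus add.assoc add_minus_cancel minus_add_cancel)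
      then have "- g + x - (- (g + y) + x) \<in> prefixes \<sigma> h"
        using j(1) unfolding y_def prefixes_def by auto
      ultimately show ?thesis by blast
    qed
  qed
  ultimately show ?thesis by blast
qed


section \<open>Coefficients in the group ring and of the quasiderivation\<close>

abbreviation coeff_abs :: "('x \<Rightarrow>\<^sub>0 complex) \<Rightarrow> 'x \<Rightarrow> real" where
  "coeff_abs a x \<equiv> cmod (Poly_Mapping.lookup a x)"

abbreviation basis_vec :: "'x \<Rightarrow> ('x \<Rightarrow>\<^sub>0 complex)" where
  "basis_vec x \<equiv> Poly_Mapping.single x 1"

lemma lookup_pm_scale [simp]: "Poly_Mapping.lookup (pm_scale c a) x = c * Poly_Mapping.lookup a x"
  unfolding pm_scale_def by (simp add: Poly_Mapping.map.rep_eq when_def)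

lemma lookup_pm_abs [simp]: "Poly_Mapping.lookup (pm_abs a) x = complex_of_real (coeff_abs a x)"
  unfolding pm_abs_def by (simp add: Poly_Mapping.map.rep_eq when_def)

lemma lookup_pm_tensor [simp]:
  "Poly_Mapping.lookup (pm_tensor a b) (x, y) = Poly_Mapping.lookup a x * Poly_Mapping.lookup b y"
proof -
  have "Poly_Mapping.lookup (pm_tensor a b) (x, y) = (\<Sum>x'\<in>Poly_Mapping.keys a. \<Sum>y'\<in>Poly_Mapping.keys b.
      if x' = x \<and> y' = y then Poly_Mapping.lookup a x * Poly_Mapping.lookup b y else 0)"
    unfolding pm_tensor_def lookup_sum by (intro sum.cong) (auto simp: lookup_single when_def)
  also have "\<dots> = (\<Sum>x'\<in>Poly_Mapping.keys a. if x' = x then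
      (\<Sum>y'\<in>Poly_Mapping.keys b. if y' = y then Poly_Mapping.lookup a x * Poly_Mapping.lookup b y else 0) else 0)"
    by (intro sum.cong) auto
  also have "\<dots> = Poly_Mapping.lookup a x * Poly_Mapping.lookup b y"
    by (auto simp: in_keys_iff)
  finally show ?thesis .
qed

lemma lookup_mult_group:
  fixes a b :: "'g::group_add \<Rightarrow>\<^sub>0 complex"
  assumes "finite F" "Poly_Mapping.keys a \<subseteq> F"
  shows "Poly_Mapping.lookup (a * b) z = (\<Sum>g\<in>F. Poly_Mapping.lookup a g * Poly_Mapping.lookup b (- g + z))"
proof -
  have inner: "(\<Sum>q. Poly_Mapping.lookup b q when z = l + q) = Poly_Mapping.lookup b (- l + z)" for l
  proof -
    have "z = l + q \<longleftrightarrow> q = - l + z" for q by (metis add.assoc add.left_neutral left_minus right_minus)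
    then show ?thesis by simp
  qed
  show ?thesis
    unfolding lookup_mult inner
    using assms by (intro Sum_any.expand_superset) (auto simp: in_keys_iff)
qed

lemma lookup_mult_basis_vec: "Poly_Mapping.lookup (a * basis_vec r) x = Poly_Mapping.lookup a (x - r)"
  for a :: "'g::group_add \<Rightarrow>\<^sub>0 complex"
proof -
  have eq: "r = - g + x \<longleftrightarrow> g = x - r" for g
    by (metis add_diff_cancel diff_add_cancel minus_add_cancel add_minus_cancel)
  have "Poly_Mapping.lookup (a * basis_vec r) x =
      (\<Sum>g\<in>Poly_Mapping.keys a. if g = x - r then Poly_Mapping.lookup a g else 0)"
    unfolding lookup_mult_group[OF finite_keys subset_refl]
    by (intro sum.cong) (auto simp: lookup_single when_def eq)
  then show ?thesis by (auto simp: in_keys_iff)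
qed

lemma lookup_basis_vec_mult: "Poly_Mapping.lookup (basis_vec r * a) x = Poly_Mapping.lookup a (- r + x)"
  for a :: "'g::group_add \<Rightarrow>\<^sub>0 complex"
  unfolding lookup_mult_group[OF finite_keys subset_refl] by simp

lemma cmod_lookup_mult_le:
  fixes a b :: "'g::group_add \<Rightarrow>\<^sub>0 complex"
  shows "coeff_abs (a * b) z \<le> (\<Sum>g\<in>Poly_Mapping.keys a. coeff_abs a g * coeff_abs b (- g + z))"
  unfolding lookup_mult_group[OF finite_keys subset_refl]
  by (rule order_trans[OF norm_sum]) (simp add: norm_mult)

text \<open>The set \<open>F\<close> is arbitrary because the lemma is used after a translation of the summation index, when
  \<open>F\<close> is a translate of the support of another element.\<close>

lemma convolution_le_lookup_mult:
  fixes a b :: "'g::group_add \<Rightarrow>\<^sub>0 complex"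
  assumes "finite F"
  shows "(\<Sum>g\<in>F. coeff_abs a g * coeff_abs b (- g + z)) \<le> coeff_abs (pm_abs a * pm_abs b) z"
proof -
  let ?G = "F \<union> Poly_Mapping.keys (pm_abs a)"
  have "(\<Sum>g\<in>F. coeff_abs a g * coeff_abs b (- g + z)) \<le> (\<Sum>g\<in>?G. coeff_abs a g * coeff_abs b (- g + z))"
    using assms by (intro sum_mono2) auto
  also have "\<dots> = coeff_abs (pm_abs a * pm_abs b) z"
  proof -
    have "Poly_Mapping.lookup (pm_abs a * pm_abs b) z =
        complex_of_real (\<Sum>g\<in>?G. coeff_abs a g * coeff_abs b (- g + z))"
      using assms by (subst lookup_mult_group[of ?G]) auto
    then show ?thesis by (simp only: norm_of_real) (simp add: sum_nonneg)
  qed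
  finally show ?thesis .
qed

text \<open>Distinct prefixes of a minimal word represent distinct group elements, so every coefficient of
  the quasiderivation of a basis vector is 0 or 1.\<close>

lemma lookup_quasiderivation_basis:
  assumes \<sigma>: "minimal_presentation S \<sigma>"
  shows "Poly_Mapping.lookup (quasiderivation_basis \<sigma> g) (x, y) =
    (if x + y = g \<and> x \<in> prefixes \<sigma> g then 1 else 0)"
proof -
  define P where "P = (\<lambda>i. sum_list (take i (\<sigma> g)))"
  define Q where "Q = (\<lambda>i. sum_list (drop i (\<sigma> g)))"
  have PQ: "P i + Q i = g" for i
  proof -
    have "P i + Q i = sum_list (\<sigma> g)"
      unfolding P_def Q_def by (simp only: sum_list_append[symmetric] append_take_drop_id)
    then show ?thesis using \<sigma> unfolding minimal_presentation_def by metis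
  qed
  have inj: "i = j" if "i \<le> length (\<sigma> g)" "j \<le> length (\<sigma> g)" "P i = P j" for i j
  proof -
    have *: "i = j" if "i \<le> j" "j \<le> length (\<sigma> g)" "P i = P j" for i j
      using minimal_presentation_subword[OF \<sigma> that(1,2)] that minimal_presentation_length_zero[OF \<sigma>]
      unfolding P_def by simp
    show ?thesis using *[of i j] *[of j i] that by (cases "i \<le> j") auto
  qed
  have "Poly_Mapping.lookup (quasiderivation_basis \<sigma> g) (x, y) =
      (\<Sum>i\<le>length (\<sigma> g). if P i = x \<and> Q i = y then 1 else 0)"
    unfolding quasiderivation_basis_def lookup_sum P_def Q_def
    by (intro sum.cong) (auto simp: lookup_single when_def)
  also have "\<dots> = (if x + y = g \<and> x \<in> prefixes \<sigma> g then 1 else 0)"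
  proof (cases "x + y = g \<and> x \<in> prefixes \<sigma> g")
    case True
    then obtain i where i: "i \<le> length (\<sigma> g)" "P i = x" unfolding prefixes_def P_def by auto
    have "P j = x \<and> Q j = y \<longleftrightarrow> j = i" if "j \<le> length (\<sigma> g)" for j
      using inj[OF that i(1)] i(2) PQ[of i] True by (metis add_left_cancel)
    then have "(\<Sum>i\<le>length (\<sigma> g). if P i = x \<and> Q i = y then 1 else 0 :: complex) =
        (\<Sum>j\<le>length (\<sigma> g). if j = i then 1 else 0)"
      by (intro sum.cong) auto
    then show ?thesis using True i(1) by simp
  next
    case False
    then have "\<not> (P j = x \<and> Q j = y)" if "j \<le> length (\<sigma> g)" for j
      using PQ[of j] that unfolding prefixes_def P_def by auto
    then show ?thesis using False by (simp add: sum.neutral)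
  qed
  finally show ?thesis .
qed

text \<open>The quasiderivation pulls \<open>\<alpha>\<close> back along the multiplication map and cuts the result off to the
  pairs in which the first entry is a prefix of the minimal word of the product. In particular,
  there is no cancellation between the basis vectors of \<open>\<alpha>\<close>.\<close>

lemma lookup_quasiderivation:
  assumes \<sigma>: "minimal_presentation S \<sigma>"
  shows "Poly_Mapping.lookup (quasiderivation \<sigma> \<alpha>) (x, y) =
    (if x \<in> prefixes \<sigma> (x + y) then Poly_Mapping.lookup \<alpha> (x + y) else 0)"
proof -
  have "Poly_Mapping.lookup (quasiderivation \<sigma> \<alpha>) (x, y) = (\<Sum>g\<in>Poly_Mapping.keys \<alpha>.
      if g = x + y then (if x \<in> prefixes \<sigma> (x + y) then Poly_Mapping.lookup \<alpha> (x + y) else 0) else 0)"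
    unfolding quasiderivation_def lookup_sum
    by (intro sum.cong) (auto simp: lookup_quasiderivation_basis[OF \<sigma>])
  then show ?thesis by (auto simp: in_keys_iff)
qed


section \<open>Majorants for the cross-norm\<close>

definition cost :: "(('x \<Rightarrow>\<^sub>0 complex) \<Rightarrow> real) \<Rightarrow> (('x \<Rightarrow>\<^sub>0 complex) \<times> ('x \<Rightarrow>\<^sub>0 complex)) list \<Rightarrow> real" where
  "cost N ps = (\<Sum>(a, b)\<leftarrow>ps. N a * N b)"

definition majorizes :: "(('x \<Rightarrow>\<^sub>0 complex) \<times> ('x \<Rightarrow>\<^sub>0 complex)) list \<Rightarrow> ('x \<times> 'x \<Rightarrow>\<^sub>0 complex) \<Rightarrow> bool" where
  "majorizes ps \<gamma> \<longleftrightarrow> (\<forall>x y. coeff_abs \<gamma> (x, y) \<le> (\<Sum>(a, b)\<leftarrow>ps. coeff_abs a x * coeff_abs b y))"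

lemma abs_le_tensors_iff_majorizes:
  "abs_le \<gamma> (\<Sum>(a, b)\<leftarrow>ps. pm_tensor (pm_abs a) (pm_abs b)) \<longleftrightarrow> majorizes ps \<gamma>"
proof -
  have lookup: "Poly_Mapping.lookup (\<Sum>(a, b)\<leftarrow>ps. pm_tensor (pm_abs a) (pm_abs b)) (x, y) =
      complex_of_real (\<Sum>(a, b)\<leftarrow>ps. coeff_abs a x * coeff_abs b y)" for x y
    by (induction ps) (auto simp: lookup_add)
  have "0 \<le> (\<Sum>(a, b)\<leftarrow>ps. coeff_abs a x * coeff_abs b y)" for x y
    by (intro sum_list_nonneg) auto
  then show ?thesis
    unfolding abs_le_def majorizes_def split_paired_All lookup norm_of_real by (simp only: abs_of_nonneg)
qed

lemma uc_norm_eq_Inf_cost: "uc_norm N \<gamma> = Inf (cost N ` {ps. majorizes ps \<gamma>})"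
  unfolding uc_norm_def abs_le_tensors_iff_majorizes cost_def setcompr_eq_image ..

lemma ex_majorizes: "\<exists>ps. majorizes ps \<gamma>"
proof -
  obtain zs where zs: "set zs = Poly_Mapping.keys \<gamma>" "distinct zs"
    using finite_distinct_list[OF finite_keys[of \<gamma>]] by metis
  let ?ps = "map (\<lambda>z. (Poly_Mapping.single (fst z) (Poly_Mapping.lookup \<gamma> z), basis_vec (snd z))) zs"
  have "coeff_abs \<gamma> (x, y) \<le> (\<Sum>(a, b)\<leftarrow>?ps. coeff_abs a x * coeff_abs b y)" for x y
  proof -
    define f where "f = (\<lambda>z. cmod (Poly_Mapping.lookup (Poly_Mapping.single (fst z) (Poly_Mapping.lookup \<gamma> z)) x) *
        coeff_abs (basis_vec (snd z)) y)"
    have "(\<Sum>(a, b)\<leftarrow>?ps. coeff_abs a x * coeff_abs b y) = (\<Sum>z\<leftarrow>zs. f z)"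
      unfolding f_def by (simp add: o_def)
    also have "\<dots> = sum f (Poly_Mapping.keys \<gamma>)"
      using zs by (simp add: sum_list_distinct_conv_sum_set)
    finally have eq: "(\<Sum>(a, b)\<leftarrow>?ps. coeff_abs a x * coeff_abs b y) = sum f (Poly_Mapping.keys \<gamma>)" .
    have nn: "0 \<le> f z" for z unfolding f_def by simp
    show ?thesis
    proof (cases "(x, y) \<in> Poly_Mapping.keys \<gamma>")
      case True
      have "coeff_abs \<gamma> (x, y) = f (x, y)" unfolding f_def by simp
      also have "\<dots> \<le> sum f (Poly_Mapping.keys \<gamma>)"
        using True nn by (intro member_le_sum) auto
      finally show ?thesis unfolding eq .
    next
      case False
      then show ?thesis unfolding eq using nn by (simp add: in_keys_iff sum_nonneg)
    qed
  qed
  then show ?thesis unfolding majorizes_def by blast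
qed

lemma cost_nonneg: "(\<And>a. 0 \<le> N a) \<Longrightarrow> 0 \<le> cost N ps"
  unfolding cost_def by (intro sum_list_nonneg) auto

lemma uc_norm_le_cost:
  assumes "\<And>a. 0 \<le> N a" "majorizes ps \<gamma>"
  shows "uc_norm N \<gamma> \<le> cost N ps"
  unfolding uc_norm_eq_Inf_cost
proof (rule cInf_lower)
  show "bdd_below (cost N ` {ps. majorizes ps \<gamma>})"
    using cost_nonneg[of N] assms(1) by (intro bdd_belowI2[of _ 0]) auto
qed (use assms(2) in simp)

lemma ex_majorizes_cost_less:
  assumes "0 < e"
  shows "\<exists>ps. majorizes ps \<gamma> \<and> cost N ps < uc_norm N \<gamma> + e"
proof -
  have "Inf (cost N ` {ps. majorizes ps \<gamma>}) < uc_norm N \<gamma> + e"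
    unfolding uc_norm_eq_Inf_cost using assms by simp
  from cInf_lessD[OF _ this] show ?thesis using ex_majorizes[of \<gamma>] by auto
qed


section \<open>Majorants of the quasiderivation of a product\<close>

text \<open>The entries for \<open>r\<close> take care of the points of a minimal word of \<open>g + h\<close> that differ by \<open>r\<close> from
  a point of one of the other two sides. If that side belongs to \<open>g\<close>, a splitting \<open>x', y'\<close> of \<open>g\<close>
  yields the splitting \<open>x' + r, - r + y' + h\<close> of \<open>g + h\<close>; this is the first kind of entry. If it
  belongs to \<open>h\<close>, a splitting \<open>x', y'\<close> of \<open>h\<close> yields \<open>g + x' + r, - r + y'\<close>; this is the second kind.\<close>

definition product_majorant :: "'g::group_add list \<Rightarrow> ('g \<Rightarrow>\<^sub>0 complex) \<Rightarrow> ('g \<Rightarrow>\<^sub>0 complex) \<Rightarrow>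
    (('g \<Rightarrow>\<^sub>0 complex) \<times> ('g \<Rightarrow>\<^sub>0 complex)) list \<Rightarrow> (('g \<Rightarrow>\<^sub>0 complex) \<times> ('g \<Rightarrow>\<^sub>0 complex)) list \<Rightarrow>
    (('g \<Rightarrow>\<^sub>0 complex) \<times> ('g \<Rightarrow>\<^sub>0 complex)) list" where
  "product_majorant rs \<alpha> \<beta> ps qs = concat (map (\<lambda>r.
     map (\<lambda>(a, b). (pm_abs a * basis_vec r, basis_vec (- r) * (pm_abs b * pm_abs \<beta>))) ps @
     map (\<lambda>(a, b). (pm_abs \<alpha> * pm_abs a * basis_vec r, basis_vec (- r) * pm_abs b)) qs) rs)"

lemma sum_list_concat_map:
  "sum_list (map f (concat (map g xs))) = (\<Sum>x\<leftarrow>xs. sum_list (map f (g x)))"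
  for f :: "'a \<Rightarrow> real"
  by (induction xs) auto

lemma sum_sum_list_swap: "(\<Sum>g\<in>F. \<Sum>z\<leftarrow>zs. f g z) = (\<Sum>z\<leftarrow>zs. \<Sum>g\<in>F. f g z)"
  for f :: "'a \<Rightarrow> 'b \<Rightarrow> real"
  by (induction zs) (auto simp: sum.distrib)

text \<open>The coefficient of \<open>quasiderivation \<sigma> (\<alpha> * \<beta>)\<close> at \<open>(x, y)\<close> is a sum over the factorisations
  \<open>x + y = g + h\<close>. Thinness assigns to each of them an \<open>r\<close> such that, after a translation by \<open>r\<close>, the
  term is also one of \<open>quasiderivation \<sigma> \<alpha>\<close> convolved on the right with \<open>\<beta>\<close>, or of
  \<open>quasiderivation \<sigma> \<beta>\<close> convolved on the left with \<open>\<alpha>\<close>. All coefficients are replaced by their absolute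
  values, so nothing is lost by adding up the terms of both kinds and for all \<open>r\<close>.\<close>

lemma majorizes_product_majorant:
  assumes \<sigma>: "minimal_presentation S \<sigma>"
    and thin: "\<And>g h x. x \<in> prefixes \<sigma> (g + h) \<Longrightarrow>
      \<exists>r\<in>set rs. x - r \<in> prefixes \<sigma> g \<or> - g + x - r \<in> prefixes \<sigma> h"
    and ps: "majorizes ps (quasiderivation \<sigma> \<alpha>)" and qs: "majorizes qs (quasiderivation \<sigma> \<beta>)"
  shows "majorizes (product_majorant rs \<alpha> \<beta> ps qs) (quasiderivation \<sigma> (\<alpha> * \<beta>))"
  unfolding majorizes_def
proof (intro allI)
  fix x y
  let ?rhs = "\<Sum>(a, b)\<leftarrow>product_majorant rs \<alpha> \<beta> ps qs. coeff_abs a x * coeff_abs b y"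
  let ?A = "Poly_Mapping.keys \<alpha>"
  \<comment> \<open>The terms of a factorisation \<open>x + y = g + h\<close> at \<open>r\<close>: \<open>L\<close> if the side of \<open>g\<close> is near, \<open>R\<close> if that of \<open>h\<close> is.\<close>
  define L where "L = (\<lambda>r g. coeff_abs (quasiderivation \<sigma> \<alpha>) (x - r, - (x - r) + g) * coeff_abs \<beta> (- g + (x + y)))"
  define R where "R = (\<lambda>r g. coeff_abs \<alpha> g * coeff_abs (quasiderivation \<sigma> \<beta>) (- g + x - r, r + y))"
  have rhs: "?rhs = (\<Sum>r\<leftarrow>rs.
      (\<Sum>(a, b)\<leftarrow>ps. coeff_abs a (x - r) * coeff_abs (pm_abs b * pm_abs \<beta>) (r + y)) +
      (\<Sum>(a, b)\<leftarrow>qs. coeff_abs (pm_abs \<alpha> * pm_abs a) (x - r) * coeff_abs b (r + y)))"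
    unfolding product_majorant_def sum_list_concat_map
    by (simp add: o_def split_def lookup_mult_basis_vec lookup_basis_vec_mult)
  have pointwise: "coeff_abs \<alpha> g * coeff_abs \<beta> (- g + (x + y)) \<le> (\<Sum>r\<leftarrow>rs. L r g + R r g)"
    if x: "x \<in> prefixes \<sigma> (x + y)" for g
  proof -
    define h where "h = - g + (x + y)"
    have gh: "g + h = x + y" unfolding h_def by (simp add: add.assoc[symmetric])
    obtain r where r: "r \<in> set rs" "x - r \<in> prefixes \<sigma> g \<or> - g + x - r \<in> prefixes \<sigma> h"
      using thin[of x g h] x unfolding gh by blast
    have nn: "0 \<le> L r g" "0 \<le> R r g" for r unfolding L_def R_def by auto
    have "x - r + (- (x - r) + g) = g" by (simp only: add_minus_cancel)
    then have L: "L r g = coeff_abs \<alpha> g * coeff_abs \<beta> h" if "x - r \<in> prefixes \<sigma> g"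
      using that unfolding L_def h_def lookup_quasiderivation[OF \<sigma>] by simp
    have "- g + x - r + (r + y) = h"
      unfolding h_def by (simp only: add.assoc[symmetric] diff_add_cancel)
    then have R: "R r g = coeff_abs \<alpha> g * coeff_abs \<beta> h" if "- g + x - r \<in> prefixes \<sigma> h"
      using that unfolding R_def lookup_quasiderivation[OF \<sigma>] by simp
    have "coeff_abs \<alpha> g * coeff_abs \<beta> h \<le> L r g + R r g"
      using r(2) L R nn[of r] by linarith
    also have "\<dots> \<le> (\<Sum>r\<leftarrow>rs. L r g + R r g)"
    proof -
      obtain us vs where "rs = us @ r # vs" using r(1) by (meson split_list)
      moreover have "0 \<le> (\<Sum>r\<leftarrow>ws. L r g + R r g)" for ws
        using nn by (intro sum_list_nonneg) (auto intro: add_nonneg_nonneg)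
      ultimately show ?thesis by (simp add: add_increasing add_increasing2)
    qed
    finally show ?thesis unfolding h_def .
  qed
  have sumL: "(\<Sum>g\<in>?A. L r g) \<le>
      (\<Sum>(a, b)\<leftarrow>ps. coeff_abs a (x - r) * coeff_abs (pm_abs b * pm_abs \<beta>) (r + y))" for r
  proof -
    let ?t = "\<lambda>g. - (x - r) + g"
    have "(\<Sum>g\<in>?A. L r g) \<le> (\<Sum>g\<in>?A. (\<Sum>(a, b)\<leftarrow>ps. coeff_abs a (x - r) * coeff_abs b (?t g)) *
        coeff_abs \<beta> (- g + (x + y)))"
      using ps unfolding L_def majorizes_def by (intro sum_mono mult_right_mono) auto
    also have "\<dots> = (\<Sum>g\<in>?A. \<Sum>(a, b)\<leftarrow>ps. coeff_abs a (x - r) * (coeff_abs b (?t g) * coeff_abs \<beta> (- g + (x + y))))"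
      by (simp add: sum_list_mult_const[symmetric] split_def mult.assoc)
    also have "\<dots> = (\<Sum>(a, b)\<leftarrow>ps. coeff_abs a (x - r) * (\<Sum>g\<in>?A. coeff_abs b (?t g) * coeff_abs \<beta> (- g + (x + y))))"
      unfolding split_def sum_sum_list_swap sum_distrib_left ..
    also have "\<dots> \<le> (\<Sum>(a, b)\<leftarrow>ps. coeff_abs a (x - r) * coeff_abs (pm_abs b * pm_abs \<beta>) (r + y))"
      unfolding split_def
    proof (intro sum_list_mono mult_left_mono)
      fix z
      \<comment> \<open>Substituting \<open>k = - (x - r) + g\<close> turns the sum into part of a convolution at \<open>r + y\<close>.\<close>
      have "- ?t g + (r + y) = - g + (x + y)" for g
        by (simp add: minus_add diff_conv_add_uminus add.assoc del: add_uminus_conv_diff)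
      then have "(\<Sum>g\<in>?A. coeff_abs (snd z) (?t g) * coeff_abs \<beta> (- g + (x + y))) =
          (\<Sum>k\<in>?t ` ?A. coeff_abs (snd z) k * coeff_abs \<beta> (- k + (r + y)))"
        by (subst sum.reindex) (auto intro: inj_onI)
      also have "\<dots> \<le> coeff_abs (pm_abs (snd z) * pm_abs \<beta>) (r + y)"
        by (intro convolution_le_lookup_mult) auto
      finally show "(\<Sum>g\<in>?A. coeff_abs (snd z) (?t g) * coeff_abs \<beta> (- g + (x + y)))
          \<le> coeff_abs (pm_abs (snd z) * pm_abs \<beta>) (r + y)" .
    qed auto
    finally show ?thesis .
  qed
  have sumR: "(\<Sum>g\<in>?A. R r g) \<le>
      (\<Sum>(a, b)\<leftarrow>qs. coeff_abs (pm_abs \<alpha> * pm_abs a) (x - r) * coeff_abs b (r + y))" for r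
  proof -
    have "(\<Sum>g\<in>?A. R r g) \<le> (\<Sum>g\<in>?A. coeff_abs \<alpha> g *
        (\<Sum>(a, b)\<leftarrow>qs. coeff_abs a (- g + (x - r)) * coeff_abs b (r + y)))"
      using qs unfolding R_def majorizes_def add_diff_eq by (intro sum_mono mult_left_mono) auto
    also have "\<dots> = (\<Sum>g\<in>?A. \<Sum>(a, b)\<leftarrow>qs. (coeff_abs \<alpha> g * coeff_abs a (- g + (x - r))) * coeff_abs b (r + y))"
      by (simp add: sum_list_const_mult[symmetric] split_def mult.assoc)
    also have "\<dots> = (\<Sum>(a, b)\<leftarrow>qs. (\<Sum>g\<in>?A. coeff_abs \<alpha> g * coeff_abs a (- g + (x - r))) * coeff_abs b (r + y))"
      unfolding split_def sum_sum_list_swap sum_distrib_right ..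
    also have "\<dots> \<le> (\<Sum>(a, b)\<leftarrow>qs. coeff_abs (pm_abs \<alpha> * pm_abs a) (x - r) * coeff_abs b (r + y))"
      unfolding split_def by (intro sum_list_mono mult_right_mono convolution_le_lookup_mult) auto
    finally show ?thesis .
  qed
  show "coeff_abs (quasiderivation \<sigma> (\<alpha> * \<beta>)) (x, y) \<le> ?rhs"
  proof (cases "x \<in> prefixes \<sigma> (x + y)")
    case False
    then have "coeff_abs (quasiderivation \<sigma> (\<alpha> * \<beta>)) (x, y) = 0" by (simp add: lookup_quasiderivation[OF \<sigma>])
    also have "0 \<le> ?rhs" by (intro sum_list_nonneg) auto
    finally show ?thesis .
  next
    case True
    then have "coeff_abs (quasiderivation \<sigma> (\<alpha> * \<beta>)) (x, y) = coeff_abs (\<alpha> * \<beta>) (x + y)"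
      by (simp add: lookup_quasiderivation[OF \<sigma>])
    also have "\<dots> \<le> (\<Sum>g\<in>?A. coeff_abs \<alpha> g * coeff_abs \<beta> (- g + (x + y)))"
      by (rule cmod_lookup_mult_le)
    also have "\<dots> \<le> (\<Sum>g\<in>?A. \<Sum>r\<leftarrow>rs. L r g + R r g)"
      using pointwise[OF True] by (intro sum_mono)
    also have "\<dots> = (\<Sum>r\<leftarrow>rs. (\<Sum>g\<in>?A. L r g) + (\<Sum>g\<in>?A. R r g))"
      by (simp add: sum_sum_list_swap sum.distrib)
    also have "\<dots> \<le> ?rhs"
      unfolding rhs by (intro sum_list_mono add_mono sumL sumR)
    finally show ?thesis .
  qed
qed

context unconditional_banach_algebra
begin

lemma N_nonneg: "0 \<le> N a"
  using seminorm unfolding seminorm_def by blast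

lemma N_mult: "N (a * b) \<le> N a * N b"
  using norm_mult_ineq[of "\<iota> a" "\<iota> b"] by (simp add: embed_mult[symmetric] embed_norm)

lemma N_pm_abs: "N (pm_abs a) = N a"
proof -
  have "abs_le (pm_abs a) a" "abs_le a (pm_abs a)" unfolding abs_le_def by auto
  then show ?thesis using unconditional unfolding unconditional_def by (meson antisym)
qed

lemma cost_product_majorant:
  "cost N (product_majorant rs \<alpha> \<beta> ps qs) \<le>
    (\<Sum>r\<leftarrow>rs. N (basis_vec r) * N (basis_vec (- r))) * (cost N ps * N \<beta> + N \<alpha> * cost N qs)"
proof -
  have mult3: "N (a * b * c) \<le> N a * N b * N c" for a b c
    using N_mult[of "a * b" c] mult_right_mono[OF N_mult[of a b] N_nonneg[of c]] by linarith
  have left: "N (pm_abs a * basis_vec r) * N (basis_vec (- r) * (pm_abs b * pm_abs \<beta>)) \<le>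
      (N (basis_vec r) * N (basis_vec (- r)) * N \<beta>) * (N a * N b)" for a b r
  proof -
    have "N (pm_abs a * basis_vec r) * N (basis_vec (- r) * pm_abs b * pm_abs \<beta>) \<le>
        (N (pm_abs a) * N (basis_vec r)) * (N (basis_vec (- r)) * N (pm_abs b) * N (pm_abs \<beta>))"
      by (intro mult_mono N_mult mult3 mult_nonneg_nonneg N_nonneg)
    then show ?thesis by (simp add: N_pm_abs mult_ac)
  qed
  have right: "N (pm_abs \<alpha> * pm_abs a * basis_vec r) * N (basis_vec (- r) * pm_abs b) \<le>
      (N (basis_vec r) * N (basis_vec (- r)) * N \<alpha>) * (N a * N b)" for a b r
  proof -
    have "N (pm_abs \<alpha> * pm_abs a * basis_vec r) * N (basis_vec (- r) * pm_abs b) \<le>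
        (N (pm_abs \<alpha>) * N (pm_abs a) * N (basis_vec r)) * (N (basis_vec (- r)) * N (pm_abs b))"
      by (intro mult_mono N_mult mult3 mult_nonneg_nonneg N_nonneg)
    then show ?thesis by (simp add: N_pm_abs mult_ac)
  qed
  have "cost N (product_majorant rs \<alpha> \<beta> ps qs) = (\<Sum>r\<leftarrow>rs.
      (\<Sum>(a, b)\<leftarrow>ps. N (pm_abs a * basis_vec r) * N (basis_vec (- r) * (pm_abs b * pm_abs \<beta>))) +
      (\<Sum>(a, b)\<leftarrow>qs. N (pm_abs \<alpha> * pm_abs a * basis_vec r) * N (basis_vec (- r) * pm_abs b)))"
    unfolding cost_def product_majorant_def sum_list_concat_map by (simp add: o_def split_def)
  also have "\<dots> \<le> (\<Sum>r\<leftarrow>rs.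
      (\<Sum>(a, b)\<leftarrow>ps. (N (basis_vec r) * N (basis_vec (- r)) * N \<beta>) * (N a * N b)) +
      (\<Sum>(a, b)\<leftarrow>qs. (N (basis_vec r) * N (basis_vec (- r)) * N \<alpha>) * (N a * N b)))"
    unfolding split_def by (intro sum_list_mono add_mono left right)
  also have "\<dots> = (\<Sum>r\<leftarrow>rs. N (basis_vec r) * N (basis_vec (- r)) * (cost N ps * N \<beta> + N \<alpha> * cost N qs))"
    unfolding cost_def split_def sum_list_const_mult by (simp add: algebra_simps)
  also have "\<dots> = (\<Sum>r\<leftarrow>rs. N (basis_vec r) * N (basis_vec (- r))) * (cost N ps * N \<beta> + N \<alpha> * cost N qs)"
    by (rule sum_list_mult_const)
  finally show ?thesis .
qed

end

theorem theorem3p3: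
  fixes S :: "'g::group_add set"
    and \<sigma> :: "'g \<Rightarrow> 'g list"
    and N :: "('g \<Rightarrow>\<^sub>0 complex) \<Rightarrow> real"
    and scaleC :: "complex \<Rightarrow> 'b::{real_normed_algebra, banach} \<Rightarrow> 'b"
    and \<iota> :: "('g \<Rightarrow>\<^sub>0 complex) \<Rightarrow> 'b"
  assumes "word_hyperbolic TYPE('g)"
    and "finite_symmetric_generating S"
    and "minimal_presentation S \<sigma>"
    and "unconditional_banach_algebra N scaleC \<iota>"
  shows "\<exists>C\<^sub>0::real. \<forall>\<alpha> \<beta> :: 'g \<Rightarrow>\<^sub>0 complex.
    uc_norm N (quasiderivation \<sigma> (\<alpha> * \<beta>))
      \<le> C\<^sub>0 * (uc_norm N (quasiderivation \<sigma> \<alpha>) * N \<beta>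
              + N \<alpha> * uc_norm N (quasiderivation \<sigma> \<beta>))"
proof -
  interpret unconditional_banach_algebra N scaleC \<iota> by (fact assms(4))
  obtain B where B: "finite B" "\<And>g h x. x \<in> prefixes \<sigma> (g + h) \<Longrightarrow>
      \<exists>r\<in>B. x - r \<in> prefixes \<sigma> g \<or> - g + x - r \<in> prefixes \<sigma> h"
    using minimal_presentation_thin_triangles[OF assms(1-3)] by blast
  obtain rs where rs: "set rs = B" using finite_list[OF B(1)] by blast
  define C where "C = (\<Sum>r\<leftarrow>rs. N (basis_vec r) * N (basis_vec (- r)))"
  have C: "0 \<le> C" unfolding C_def by (intro sum_list_nonneg) (auto intro: N_nonneg mult_nonneg_nonneg)
  have "uc_norm N (quasiderivation \<sigma> (\<alpha> * \<beta>))
      \<le> C * (uc_norm N (quasiderivation \<sigma> \<alpha>) * N \<beta> + N \<alpha> * uc_norm N (quasiderivation \<sigma> \<beta>))" for \<alpha> \<beta>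
  proof (rule field_le_epsilon)
    fix e :: real assume e: "0 < e"
    let ?U = "uc_norm N (quasiderivation \<sigma> \<alpha>)" and ?V = "uc_norm N (quasiderivation \<sigma> \<beta>)"
    \<comment> \<open>The summand 1 makes the divisor in \<open>e / c\<close> positive when \<open>N\<close> vanishes on \<open>\<alpha>\<close> and \<open>\<beta>\<close>.\<close>
    define c where "c = C * (N \<beta> + N \<alpha>) + 1"
    have c: "0 < c" "C * (N \<beta> + N \<alpha>) \<le> c"
      unfolding c_def using C N_nonneg[of \<alpha>] N_nonneg[of \<beta>] by (simp_all add: add_nonneg_pos)
    obtain ps where ps: "majorizes ps (quasiderivation \<sigma> \<alpha>)" "cost N ps < ?U + e / c"
      using ex_majorizes_cost_less e c(1) by (meson divide_pos_pos)
    obtain qs where qs: "majorizes qs (quasiderivation \<sigma> \<beta>)" "cost N qs < ?V + e / c"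
      using ex_majorizes_cost_less e c(1) by (meson divide_pos_pos)
    have "uc_norm N (quasiderivation \<sigma> (\<alpha> * \<beta>)) \<le> cost N (product_majorant rs \<alpha> \<beta> ps qs)"
      using B(2) rs ps(1) qs(1)
      by (intro uc_norm_le_cost N_nonneg majorizes_product_majorant[OF assms(3)]) auto
    also have "\<dots> \<le> C * (cost N ps * N \<beta> + N \<alpha> * cost N qs)"
      unfolding C_def by (rule cost_product_majorant)
    also have "\<dots> \<le> C * ((?U + e / c) * N \<beta> + N \<alpha> * (?V + e / c))"
      using ps(2) qs(2) C N_nonneg by (intro mult_left_mono add_mono mult_right_mono) auto
    also have "\<dots> = C * (?U * N \<beta> + N \<alpha> * ?V) + (C * (N \<beta> + N \<alpha>)) * (e / c)"
      by (simp add: algebra_simps)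
    also have "\<dots> \<le> C * (?U * N \<beta> + N \<alpha> * ?V) + c * (e / c)"
      using c e by (intro add_left_mono mult_right_mono) auto
    finally show "uc_norm N (quasiderivation \<sigma> (\<alpha> * \<beta>)) \<le> C * (?U * N \<beta> + N \<alpha> * ?V) + e"
      using c(1) by simp
  qed
  then show ?thesis by blast
qed

end
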